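(* Let $\mathfrak{o}$ be a Dedekind domain, let $n$ be a positive integer, and let $\mathfrak{a}_1,\ldots,\mathfrak{a}_n$, $\mathfrak{b}_1,\ldots,\mathfrak{b}_n$, $\mathfrak{c}_1,\ldots,\mathfrak{c}_n$ be nonzero ideals of $\mathfrak{o}$. The triple $((\mathfrak{a}_1,\ldots,\mathfrak{a}_n),(\mathfrak{b}_1,\ldots,\mathfrak{b}_n),(\mathfrak{c}_1,\ldots,\mathfrak{c}_n))$ is realisable if $\mathfrak{c}_k = \mathfrak{a}_k\mathfrak{b}_k$ holds for all $1\le k\le n$ and the following conditions are satisfied: (1) $\mathfrak{a}_n$, $\mathfrak{b}_n$ and $\mathfrak{c}_n$ are principal ideals. (2) $\mathfrak{a}_1^2 \mid \mathfrak{a}_2$, $\mathfrak{b}_1^2 \mid \mathfrak{b}_2$ and $\mathfrak{c}_1^2 \mid \mathfrak{c}_2$ (this condition being void if $n=1$). (3) $\mathfrak{a}_{k-1}^2\mathfrak{a}_{k-2}^{-1} \mid \mathfrak{a}_k$, $\mathfrak{b}_{k-1}^2\mathfrak{b}_{k-2}^{-1} \mid \mathfrak{b}_k$ and $\mathfrak{c}_{k-1}^2\mathfrak{c}_{k-2}^{-1} \mid \mathfrak{c}_k$ for all $3 \le k \le n$.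
   Context: $I_n$ denotes the set of $n \times n$ matrices with entries in $\mathfrak{o}$ and non-zero determinant. For $A \in \mathfrak{o}^{n\times n}$ and $1 \le k \le n$, the $k$-th determinantal divisor $\mathfrak{d}_k(A)$ is the ideal of $\mathfrak{o}$ generated by all $k\times k$ minors of $A$ (their ideal-theoretic g.c.d.). The triple $((\mathfrak{a}_1,\ldots,\mathfrak{a}_n),(\mathfrak{b}_1,\ldots,\mathfrak{b}_n),(\mathfrak{c}_1,\ldots,\mathfrak{c}_n))$ is called realisable if there exist matrices $A, B \in I_n$ such that $\mathfrak{d}_k(A)=\mathfrak{a}_k$, $\mathfrak{d}_k(B)=\mathfrak{b}_k$ and $\mathfrak{d}_k(AB)=\mathfrak{c}_k$ for all $1 \le k \le n$. Inverses and products are those of fractional ideals in the field of fractions of $\mathfrak{o}$, and for fractional ideals $\mathfrak{a} \mid \mathfrak{b}$ means $\mathfrak{b} \subseteq \mathfrak{a}$. *)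

theory Defs
  imports
    "Jordan_Normal_Form.Determinant"
    "Jordan_Normal_Form.DL_Submatrix"
    "HOL-Computational_Algebra.Polynomial_Factorial"
begin

(* The ring is the whole type 'a; its field of fractions is 'a fract, with embedding to_fract.
   Ideals are the submodules (Modules.module.subspace) of 'a over itself, and fractional ideals are
   submodules of 'a fract over 'a. *)

definition frac_scale :: "'a::idom \<Rightarrow> 'a fract \<Rightarrow> 'a fract" where
  "frac_scale r x = to_fract r * x"

lemma module_mult: "Modules.module ((*) :: 'a::comm_ring_1 \<Rightarrow> 'a \<Rightarrow> 'a)"
  by unfold_locales (simp_all add: algebra_simps)

lemma module_frac_scale: "Modules.module (frac_scale :: 'a::idom \<Rightarrow> 'a fract \<Rightarrow> 'a fract)"
  by unfold_locales (simp_all add: frac_scale_def algebra_simps)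

definition is_ideal :: "'a::comm_ring_1 set \<Rightarrow> bool" where
  "is_ideal I \<longleftrightarrow> Modules.module.subspace (*) I"

definition ideal_gen :: "'a::comm_ring_1 set \<Rightarrow> 'a set" where
  "ideal_gen S = Modules.module.span (*) S"

definition principal_ideal :: "'a::comm_ring_1 set \<Rightarrow> bool" where
  "principal_ideal I \<longleftrightarrow> (\<exists>x. I = ideal_gen {x})"

definition prime_ideal :: "'a::comm_ring_1 set \<Rightarrow> bool" where
  "prime_ideal P \<longleftrightarrow>
     is_ideal P \<and> P \<noteq> UNIV \<and> (\<forall>x y. x * y \<in> P \<longrightarrow> x \<in> P \<or> y \<in> P)"

definition maximal_ideal :: "'a::comm_ring_1 set \<Rightarrow> bool" where
  "maximal_ideal M \<longleftrightarrow>
     is_ideal M \<and> M \<noteq> UNIV \<and> (\<forall>J. is_ideal J \<and> M \<subseteq> J \<longrightarrow> J = M \<or> J = UNIV)"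

definition noetherian :: "'a::comm_ring_1 itself \<Rightarrow> bool" where
  "noetherian _ \<longleftrightarrow> (\<forall>I::'a set. is_ideal I \<longrightarrow> (\<exists>S. finite S \<and> I = ideal_gen S))"

definition integrally_closed :: "'a::idom itself \<Rightarrow> bool" where
  "integrally_closed _ \<longleftrightarrow>
     (\<forall>(x::'a fract) (p::'a poly). lead_coeff p = 1 \<and> poly (map_poly to_fract p) x = 0
        \<longrightarrow> x \<in> range to_fract)"

(* Fields are not excluded. *)
definition dedekind_domain :: "'a::idom itself \<Rightarrow> bool" where
  "dedekind_domain T \<longleftrightarrow> noetherian T \<and> integrally_closed T \<and>
     (\<forall>P::'a set. prime_ideal P \<and> P \<noteq> {0} \<longrightarrow> maximal_ideal P)"

definition ideal_mult :: "'a::comm_ring_1 set \<Rightarrow> 'a set \<Rightarrow> 'a set" where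
  "ideal_mult I J = ideal_gen {x * y | x y. x \<in> I \<and> y \<in> J}"

definition frac_ideal :: "'a::idom set \<Rightarrow> 'a fract set" where
  "frac_ideal I = to_fract ` I"

definition frac_mult :: "'a::idom fract set \<Rightarrow> 'a fract set \<Rightarrow> 'a fract set" where
  "frac_mult I J = Modules.module.span frac_scale {x * y | x y. x \<in> I \<and> y \<in> J}"

definition frac_inverse :: "'a::idom fract set \<Rightarrow> 'a fract set" where
  "frac_inverse I = {x. \<forall>y\<in>I. x * y \<in> range to_fract}"

(* Used both for ideals of 'a and for fractional ideals. *)
definition ideal_divides :: "'b set \<Rightarrow> 'b set \<Rightarrow> bool" where
  "ideal_divides I J \<longleftrightarrow> J \<subseteq> I"

definition nonsing_mats :: "nat \<Rightarrow> 'a::idom mat set" where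
  "nonsing_mats n = {A \<in> carrier_mat n n. det A \<noteq> 0}"

definition minors :: "nat \<Rightarrow> 'a::comm_ring_1 mat \<Rightarrow> 'a set" where
  "minors k A = {det (submatrix A I J) | I J.
     I \<subseteq> {..<dim_row A} \<and> J \<subseteq> {..<dim_col A} \<and> card I = k \<and> card J = k}"

definition det_divisor :: "nat \<Rightarrow> 'a::comm_ring_1 mat \<Rightarrow> 'a set" where
  "det_divisor k A = ideal_gen (minors k A)"

(* Sequences are indexed from 1; only the values at 1..n matter. *)
definition realisable ::
    "nat \<Rightarrow> (nat \<Rightarrow> 'a::idom set) \<Rightarrow> (nat \<Rightarrow> 'a set) \<Rightarrow> (nat \<Rightarrow> 'a set) \<Rightarrow> bool" where
  "realisable n a b c \<longleftrightarrow> (\<exists>A\<in>nonsing_mats n. \<exists>B\<in>nonsing_mats n. \<forall>k\<in>{1..n}.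
     det_divisor k A = a k \<and> det_divisor k B = b k \<and> det_divisor k (A * B) = c k)"

end

theory Submission
  imports Defs
begin

text \<open>
  Write \<open>o\<close> for the ring and \<open>K\<close> for its field of fractions. The hypotheses \<open>cond2\<close> and \<open>cond3\<close> say that
  the quotients \<open>\<alpha>\<^sub>i = a\<^sub>i a\<^sub>i\<^sub>-\<^sub>1\<inverse>\<close> and \<open>\<beta>\<^sub>i = b\<^sub>i b\<^sub>i\<^sub>-\<^sub>1\<inverse>\<close> (with \<open>a\<^sub>0 = b\<^sub>0 = o\<close>) are integral ideals that form
  descending chains; they are the invariant factors of the matrices to be found
  (\<open>invariant_factorsE\<close>).

  The matrices come from the chain of lattices
  \<open>o\<^sup>n \<supseteq> \<alpha>\<^sub>1 \<oplus> \<dots> \<oplus> \<alpha>\<^sub>n \<supseteq> \<alpha>\<^sub>1\<beta>\<^sub>1 \<oplus> \<dots> \<oplus> \<alpha>\<^sub>n\<beta>\<^sub>n\<close>. By \<open>cond1\<close> the products \<open>\<alpha>\<^sub>1\<cdots>\<alpha>\<^sub>n = a\<^sub>n\<close> and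
  \<open>(\<alpha>\<^sub>1\<beta>\<^sub>1)\<cdots>(\<alpha>\<^sub>n\<beta>\<^sub>n) = a\<^sub>n b\<^sub>n\<close> are principal, so by Steinitz's theorem all three lattices are free
  (\<open>steinitz_free\<close>). If the columns of \<open>X\<close> and \<open>Z\<close> are bases of the second and the third lattice, then
  \<open>A = X\<close> and \<open>B = X\<inverse> Z\<close> have entries in \<open>o\<close>, and \<open>A B = Z\<close>.

  The divisors of \<open>A\<close>, \<open>B\<close> and \<open>A B\<close> are read off from one statement
  (\<open>det_divisor_between_sums\<close>): a matrix that describes an inclusion
  \<open>\<sigma>\<^sub>1\<beta>\<^sub>1 \<oplus> \<dots> \<oplus> \<sigma>\<^sub>n\<beta>\<^sub>n \<subseteq> \<sigma>\<^sub>1 \<oplus> \<dots> \<oplus> \<sigma>\<^sub>n\<close> of free lattices with \<open>\<beta>\<close> descending has \<open>k\<close>-th determinantal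
  divisor \<open>\<beta>\<^sub>1\<cdots>\<beta>\<^sub>k\<close>. Both inclusions follow from expanding a minor of a product of matrices
  by multilinearity and estimating each summand by the ideals in which the entries lie.

  Steinitz's theorem rests on two facts about a Dedekind domain: nonzero ideals are invertible
  (\<open>ideal_invertible\<close>), and two invertible modules \<open>I\<close>, \<open>J\<close> contain elements \<open>x\<close>, \<open>y\<close> with
  \<open>x I\<inverse> + y J\<inverse> = o\<close> (\<open>ex_comaximal_elements\<close>). These are proved here from the definition of a
  Dedekind domain as an integrally closed Noetherian domain whose nonzero primes are maximal. Ideals
  and fractional ideals are treated together, as elements of the commutative ordered semiring of all
  \<open>o\<close>-submodules of \<open>K\<close>, in which \<open>o\<close> is the unit and the ideals are the elements below \<open>1\<close>.
\<close>

section \<open>Submodules of the field of fractions as an ordered semiring\<close>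

global_interpretation frac: Modules.module "frac_scale :: 'a::idom \<Rightarrow> 'a fract \<Rightarrow> 'a fract"
  by (rule module_frac_scale)

text \<open>A type of its own, rather than a predicate on sets, lets sums and products of modules use the
  simplification rules and big operators of commutative semirings.\<close>

typedef (overloaded) 'a::idom submod = "{M :: 'a fract set. frac.subspace M}"
  morphisms elts Submod
  by (rule exI[of _ "{0}"]) simp

lemma subspace_elts [simp]: "frac.subspace (elts M)"
  using elts[of M] by simp

lemma elts_0 [simp]: "0 \<in> elts M"
  using frac.subspace_0 subspace_elts by blast

lemma elts_add: "x \<in> elts M \<Longrightarrow> y \<in> elts M \<Longrightarrow> x + y \<in> elts M"
  using frac.subspace_add subspace_elts by blast

lemma elts_diff: "x \<in> elts M \<Longrightarrow> y \<in> elts M \<Longrightarrow> x - y \<in> elts M"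
  using frac.subspace_diff subspace_elts by blast

lemma elts_uminus: "x \<in> elts M \<Longrightarrow> - x \<in> elts M"
  using frac.subspace_neg subspace_elts by blast

lemma elts_scale: "x \<in> elts M \<Longrightarrow> to_fract r * x \<in> elts M"
  using frac.subspace_scale[OF subspace_elts[of M], of x r] by (simp add: frac_scale_def)

lemma elts_sum: "(\<And>i. i \<in> A \<Longrightarrow> f i \<in> elts M) \<Longrightarrow> sum f A \<in> elts M"
  by (rule frac.subspace_sum) auto

definition generated :: "'a::idom fract set \<Rightarrow> 'a submod" where
  "generated S = Submod (frac.span S)"

lemma elts_generated: "elts (generated S) = frac.span S"
  by (simp add: generated_def Submod_inverse)

instantiation submod :: (idom) order
begin
definition less_eq_submod_def: "M \<le> N \<longleftrightarrow> elts M \<subseteq> elts N"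
definition less_submod_def: "M < N \<longleftrightarrow> elts M \<subset> elts N"
instance
  by standard (auto simp: less_eq_submod_def less_submod_def elts_inject)
end

lemma submod_leI: "(\<And>x. x \<in> elts M \<Longrightarrow> x \<in> elts N) \<Longrightarrow> M \<le> N"
  by (auto simp: less_eq_submod_def)

lemma submod_leD: "M \<le> N \<Longrightarrow> x \<in> elts M \<Longrightarrow> x \<in> elts N"
  by (auto simp: less_eq_submod_def)

lemma generated_le_iff: "generated S \<le> M \<longleftrightarrow> S \<subseteq> elts M"
  unfolding less_eq_submod_def elts_generated
  using frac.span_superset frac.span_minimal subspace_elts by (metis order_trans)

lemma generated_base: "x \<in> S \<Longrightarrow> x \<in> elts (generated S)"
  by (simp add: elts_generated frac.span_base)

instantiation submod :: (idom) "{zero, one, plus, times}"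
begin
definition zero_submod_def: "0 = Submod {0}"
definition one_submod_def: "1 = Submod (range to_fract)"
definition plus_submod_def: "M + N = Submod {x + y | x y. x \<in> elts M \<and> y \<in> elts N}"
definition times_submod_def: "M * N = generated {x * y | x y. x \<in> elts M \<and> y \<in> elts N}"
instance ..
end

lemma elts_zero [simp]: "elts 0 = {0}"
  by (simp add: zero_submod_def Submod_inverse)

lemma elts_one: "elts 1 = range to_fract"
proof -
  have "frac.subspace (range (to_fract :: 'a \<Rightarrow> _))"
    by (rule frac.subspaceI)
      (auto simp: frac_scale_def simp flip: to_fract_add to_fract_mult intro: rev_image_eqI[of 0])
  then show ?thesis by (simp add: one_submod_def Submod_inverse)
qed

lemma one_in_one [simp]: "1 \<in> elts 1"
  unfolding elts_one by (rule rev_image_eqI[of 1]) auto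

lemma elts_plus: "elts (M + N) = {x + y | x y. x \<in> elts M \<and> y \<in> elts N}"
proof -
  have "{x + y | x y. x \<in> elts M \<and> y \<in> elts N} = frac.span (elts M \<union> elts N)"
    unfolding frac.span_Un by (metis (no_types, opaque_lifting) frac.span_eq_iff subspace_elts)
  then show ?thesis
    by (metis (mono_tags, lifting) Submod_inverse frac.subspace_span mem_Collect_eq plus_submod_def)
qed

lemma submod_zero_le [simp]: "0 \<le> (M :: 'a::idom submod)"
  by (simp add: less_eq_submod_def)

lemma plus_le_iff: "M + N \<le> (L :: 'a::idom submod) \<longleftrightarrow> M \<le> L \<and> N \<le> L"
proof
  assume *: "M + N \<le> L"
  have "x \<in> elts L" if "x \<in> elts M" for x
    using submod_leD[OF *, of x] that unfolding elts_plus by force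
  moreover have "x \<in> elts L" if "x \<in> elts N" for x
    using submod_leD[OF *, of x] that unfolding elts_plus by force
  ultimately show "M \<le> L \<and> N \<le> L" by (auto intro: submod_leI)
qed (auto intro!: submod_leI elts_add dest: submod_leD simp: elts_plus)

lemma times_le_iff: "M * N \<le> L \<longleftrightarrow> (\<forall>x\<in>elts M. \<forall>y\<in>elts N. x * y \<in> elts L)"
  unfolding times_submod_def generated_le_iff by blast

lemma times_elts: "x \<in> elts M \<Longrightarrow> y \<in> elts N \<Longrightarrow> x * y \<in> elts (M * N)"
  using times_le_iff by blast

text \<open>The colon module \<open>(L : S)\<close>. It is the right adjoint of multiplication (\<open>le_residual_iff\<close>), and
  this adjunction is what makes associativity and distributivity of the product easy.\<close>

definition residual :: "'a::idom submod \<Rightarrow> 'a fract set \<Rightarrow> 'a submod" where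
  "residual L S = Submod {x. \<forall>y\<in>S. x * y \<in> elts L}"

lemma elts_residual: "elts (residual L S) = {x. \<forall>y\<in>S. x * y \<in> elts L}"
proof -
  have "frac.subspace {x. \<forall>y\<in>S. x * y \<in> elts L}"
    by (rule frac.subspaceI) (auto simp: frac_scale_def distrib_right mult.assoc elts_add elts_scale)
  then show ?thesis by (simp add: residual_def Submod_inverse)
qed

lemma le_residual_iff: "M \<le> residual L (elts N) \<longleftrightarrow> M * N \<le> L"
  unfolding times_le_iff by (auto simp: less_eq_submod_def elts_residual)

lemma times_times_le_iff:
  "(M * N) * P \<le> L \<longleftrightarrow> (\<forall>x\<in>elts M. \<forall>y\<in>elts N. \<forall>z\<in>elts P. x * y * z \<in> elts L)"
  unfolding le_residual_iff[symmetric] by (auto simp: less_eq_submod_def elts_residual)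

lemma times_submod_commute: "M * N = N * (M :: 'a::idom submod)"
  by (rule antisym; unfold times_le_iff; metis times_elts mult.commute)

text \<open>The semiring laws are proved by comparing, for both sides, the modules that lie above them: an
  inclusion \<open>M * N \<le> L\<close> can be tested on products of single elements.\<close>

instance submod :: (idom) ordered_comm_semiring
proof
  fix M N P L :: "'a submod"
  have le_iff: "M + N + P \<le> L \<longleftrightarrow> M + (N + P) \<le> L" "M + N \<le> L \<longleftrightarrow> N + M \<le> L" "0 + M \<le> L \<longleftrightarrow> M \<le> L"
    for L :: "'a submod"
    unfolding plus_le_iff by auto
  show "M + N + P = M + (N + P)" "M + N = N + M" "0 + M = M"
    by (rule antisym; use le_iff in blast)+
  have "(M * N) * P \<le> L \<longleftrightarrow> (N * P) * M \<le> L" for L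
    unfolding times_times_le_iff by (intro iffI ballI; metis mult.commute mult.assoc)
  then have "(M * N) * P = (N * P) * M"
    by (metis antisym order_refl)
  then show "M * N * P = M * (N * P)"
    by (simp add: times_submod_commute)
  show "M * N = N * M" by (rule times_submod_commute)
  have "0 * M \<le> 0" by (auto simp: times_le_iff)
  then show "0 * M = 0" by (simp add: antisym)
  then show "M * 0 = 0" by (simp add: times_submod_commute)
  have "(M + N) * P \<le> L \<longleftrightarrow> M * P + N * P \<le> L" for L
    unfolding le_residual_iff[symmetric] plus_le_iff by simp
  then show "(M + N) * P = M * P + N * P"
    by (metis antisym order_refl)
  show "M \<le> N \<Longrightarrow> P + M \<le> P + N"
    by (auto simp: less_eq_submod_def elts_plus)
  show "M \<le> N \<Longrightarrow> P * M \<le> P * N"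
    by (auto simp: times_le_iff intro: times_elts dest: submod_leD)
qed

instance submod :: (idom) comm_semiring_1
proof
  fix M :: "'a submod"
  have "(1 * M \<le> L) = (M \<le> L)" for L
    unfolding times_le_iff by (auto simp: elts_one less_eq_submod_def elts_scale)
      (metis to_fract_1 mult_1 subsetI)
  then show "1 * M = M"
    by (metis antisym order_refl)
  show "(0 :: 'a submod) \<noteq> 1"
    using one_in_one elts_zero by (metis singletonD zero_neq_one)
qed

lemma submod_mult_mono: "M \<le> M' \<Longrightarrow> N \<le> N' \<Longrightarrow> M * N \<le> M' * (N' :: 'a::idom submod)"
  by (rule mult_mono) auto

lemma submod_mult_right_mono: "M \<le> M' \<Longrightarrow> M * N \<le> M' * (N :: 'a::idom submod)"
  by (rule submod_mult_mono) auto

lemma submod_mult_left_mono: "M \<le> M' \<Longrightarrow> N * M \<le> N * (M' :: 'a::idom submod)"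
  by (rule submod_mult_mono) auto

lemma elts_prod: "(\<And>i. i \<in> A \<Longrightarrow> f i \<in> elts (M i)) \<Longrightarrow> prod f A \<in> elts (prod M A)"
  by (induction A rule: infinite_finite_induct) (auto intro: times_elts)

definition cyclic :: "'a::idom fract \<Rightarrow> 'a submod" where
  "cyclic x = generated {x}"

lemma cyclic_le_iff [simp]: "cyclic x \<le> M \<longleftrightarrow> x \<in> elts M"
  by (simp add: cyclic_def generated_le_iff)

lemma cyclic_self [simp]: "x \<in> elts (cyclic x)"
  using cyclic_le_iff by blast

lemma elts_cyclic: "elts (cyclic x) = range (\<lambda>r. to_fract r * x)"
  by (simp add: cyclic_def elts_generated frac.span_singleton frac_scale_def)

lemma cyclic_times_le_iff: "cyclic x * M \<le> L \<longleftrightarrow> (\<forall>y\<in>elts M. x * y \<in> elts L)"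
proof -
  have "cyclic x * M \<le> L \<longleftrightarrow> x \<in> elts (residual L (elts M))"
    by (simp flip: le_residual_iff)
  then show ?thesis by (simp add: elts_residual)
qed

lemma cyclic_mult: "cyclic x * cyclic y = cyclic (x * y)"
proof -
  have "cyclic x * cyclic y \<le> L \<longleftrightarrow> cyclic (x * y) \<le> L" for L
    by (simp add: cyclic_times_le_iff elts_cyclic)
      (metis (no_types, opaque_lifting) elts_scale mult.left_commute mult_1 to_fract_1)
  then show ?thesis by (metis antisym order_refl)
qed

lemma cyclic_1 [simp]: "cyclic 1 = 1"
  by (auto simp: elts_cyclic elts_one simp flip: elts_inject)

lemma cyclic_0 [simp]: "cyclic 0 = 0"
  by (auto simp: elts_cyclic simp flip: elts_inject)

lemma cyclic_times_inverse [simp]: "x \<noteq> 0 \<Longrightarrow> cyclic x * cyclic (inverse x) = 1"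
  by (simp add: cyclic_mult)

lemma times_cyclic_elts: "y \<in> elts M \<Longrightarrow> x * y \<in> elts (cyclic x * M)"
  by (simp add: times_elts)

lemma elts_cyclic_times:
  assumes "z \<in> elts (cyclic x * M)" shows "\<exists>y\<in>elts M. z = x * y"
proof (cases "x = 0")
  case True
  then show ?thesis using assms by (auto intro!: exI[of _ 0])
next
  case False
  have "inverse x * z \<in> elts (cyclic (inverse x) * (cyclic x * M))"
    using assms by (rule times_cyclic_elts)
  also have "cyclic (inverse x) * (cyclic x * M) = M"
    using False by (simp add: cyclic_mult flip: mult.assoc)
  finally show ?thesis using False by (intro bexI[of _ "inverse x * z"]) auto
qed

lemma submod_nonzeroE:
  assumes "M \<noteq> 0" obtains x where "x \<in> elts M" "x \<noteq> 0"
proof -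
  have "elts M \<noteq> {0}" using assms by (simp flip: elts_inject)
  with elts_0[of M] show ?thesis using that by blast
qed

lemma elts_le_one: "M \<le> 1 \<Longrightarrow> x \<in> elts M \<Longrightarrow> \<exists>r. x = to_fract r"
  unfolding less_eq_submod_def elts_one by blast

lemma one_le_iff: "1 \<le> M \<longleftrightarrow> 1 \<in> elts M"
  by (metis cyclic_1 cyclic_le_iff)

text \<open>The largest module whose product with \<open>M\<close> is integral, \<open>(o : M)\<close>. It exists for every \<open>M\<close>, and is an
  inverse of \<open>M\<close> as soon as there is any (\<open>inv_mod_unique\<close>).\<close>

definition inv_mod :: "'a::idom submod \<Rightarrow> 'a submod" where
  "inv_mod M = residual 1 (elts M)"

definition invertible_mod :: "'a::idom submod \<Rightarrow> bool" where
  "invertible_mod M \<longleftrightarrow> M * inv_mod M = 1"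

lemma le_inv_mod_iff: "N \<le> inv_mod M \<longleftrightarrow> N * M \<le> 1"
  by (simp add: inv_mod_def le_residual_iff)

lemma inv_mod_unique:
  assumes "M * N = 1" shows "inv_mod M = N"
proof (rule antisym)
  have "inv_mod M * M \<le> 1" by (simp flip: le_inv_mod_iff)
  then have "inv_mod M * M * N \<le> 1 * N" by (rule submod_mult_right_mono)
  then show "inv_mod M \<le> N" using assms by (simp add: mult.assoc)
  show "N \<le> inv_mod M" using assms by (simp add: le_inv_mod_iff mult.commute)
qed

lemma invertibleI: "M * N = 1 \<Longrightarrow> invertible_mod M"
  by (simp add: invertible_mod_def inv_mod_unique)

lemma invertible_inv [simp]: "invertible_mod M \<Longrightarrow> M * inv_mod M = 1"
    "invertible_mod M \<Longrightarrow> inv_mod M * M = 1"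
  by (simp_all add: invertible_mod_def mult.commute)

lemma invertible_cancel [simp]: 
    "invertible_mod M \<Longrightarrow> M * (inv_mod M * N) = N"
    "invertible_mod M \<Longrightarrow> inv_mod M * (M * N) = N"
  by (simp_all flip: mult.assoc)

lemma invertible_one [simp]: "invertible_mod 1" and inv_mod_one [simp]: "inv_mod 1 = 1"
  by (auto intro: invertibleI inv_mod_unique)

lemma invertible_cyclic: "x \<noteq> 0 \<Longrightarrow> invertible_mod (cyclic x)"
  by (rule invertibleI) (rule cyclic_times_inverse)

lemma invertible_inv_mod [simp]: "invertible_mod M \<Longrightarrow> invertible_mod (inv_mod M)"
  by (rule invertibleI[of _ M]) simp

lemma
  assumes "invertible_mod M" "invertible_mod N"
  shows invertible_mult [simp]: "invertible_mod (M * N)"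
    and inv_mod_mult: "inv_mod (M * N) = inv_mod M * inv_mod N"
proof -
  have "(M * N) * (inv_mod M * inv_mod N) = (M * inv_mod M) * (N * inv_mod N)"
    by (simp only: mult_ac)
  then have "(M * N) * (inv_mod M * inv_mod N) = 1" using assms by simp
  then show "invertible_mod (M * N)" "inv_mod (M * N) = inv_mod M * inv_mod N"
    by (auto intro: invertibleI inv_mod_unique)
qed

lemma invertible_prod: "(\<And>i. i \<in> A \<Longrightarrow> invertible_mod (M i)) \<Longrightarrow> invertible_mod (prod M A)"
  by (induction A rule: infinite_finite_induct) auto

lemma invertible_le_iff:
  assumes "invertible_mod P"
  shows "P * M \<le> P * N \<longleftrightarrow> M \<le> N"
  using submod_mult_left_mono[of "P * M" "P * N" "inv_mod P"] submod_mult_left_mono[of M N P] assms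
  by auto

section \<open>Ideals as submodules of the field of fractions\<close>

definition integral_part :: "'a::idom submod \<Rightarrow> 'a set" where
  "integral_part M = {r. to_fract r \<in> elts M}"

lemma is_ideal_iff:
  "is_ideal I \<longleftrightarrow> 0 \<in> I \<and> (\<forall>x\<in>I. \<forall>y\<in>I. x + y \<in> I) \<and> (\<forall>c. \<forall>x\<in>I. c * x \<in> I)"
  by (simp add: is_ideal_def Modules.module.subspace_def[OF module_mult])

lemma ideal_gen_subset_iff: "is_ideal I \<Longrightarrow> ideal_gen S \<subseteq> I \<longleftrightarrow> S \<subseteq> I"
  unfolding is_ideal_def ideal_gen_def
  using Modules.module.span_minimal[OF module_mult] Modules.module.span_superset[OF module_mult]
  by (metis order_trans)

lemma ideal_gen_superset: "S \<subseteq> ideal_gen S"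
  unfolding ideal_gen_def by (rule Modules.module.span_superset[OF module_mult])

lemma is_ideal_gen: "is_ideal (ideal_gen S)"
  by (simp add: is_ideal_def ideal_gen_def Modules.module.subspace_span[OF module_mult])

lemma ideal_gen_mult: "x \<in> ideal_gen S \<Longrightarrow> c * x \<in> ideal_gen S"
  using is_ideal_gen[of S] by (simp add: is_ideal_iff)

lemma is_ideal_integral_part: "is_ideal (integral_part M)"
  by (auto simp: is_ideal_iff integral_part_def elts_add elts_scale)

lemma integral_part_subset_iff:
  assumes "M \<le> 1"
  shows "integral_part M \<subseteq> integral_part N \<longleftrightarrow> M \<le> N"
proof
  assume *: "integral_part M \<subseteq> integral_part N"
  show "M \<le> N"
  proof (rule submod_leI)
    fix x assume x: "x \<in> elts M"
    then obtain r where "x = to_fract r" using elts_le_one[OF assms] by blast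
    then show "x \<in> elts N" using * x by (auto simp: integral_part_def)
  qed
qed (auto simp: integral_part_def dest: submod_leD)

text \<open>The image of an ideal in the field of fractions. Taking the generated module makes this meaningful
  for every set; for an ideal nothing is added (\<open>elts_of_ideal\<close>).\<close>

definition of_ideal :: "'a::idom set \<Rightarrow> 'a submod" where
  "of_ideal I = generated (frac_ideal I)"

lemma of_ideal_le_iff: "of_ideal I \<le> M \<longleftrightarrow> I \<subseteq> integral_part M"
  by (auto simp: of_ideal_def generated_le_iff frac_ideal_def integral_part_def)

lemma of_ideal_le_one: "of_ideal I \<le> 1"
  unfolding of_ideal_le_iff by (auto simp: integral_part_def elts_one)

lemma elts_of_ideal:
  assumes "is_ideal I"
  shows "elts (of_ideal I) = frac_ideal I"
proof -
  have "frac.subspace (frac_ideal I)"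
    using assms unfolding frac_ideal_def is_ideal_iff
    by (intro frac.subspaceI)
      (auto simp: frac_scale_def simp flip: to_fract_add to_fract_mult to_fract_0)
  then show ?thesis unfolding of_ideal_def elts_generated by simp
qed

lemma integral_part_of_ideal:
  assumes "is_ideal I" shows "integral_part (of_ideal I) = I"
  by (auto simp: integral_part_def elts_of_ideal[OF assms] frac_ideal_def)

lemma of_ideal_mono: "is_ideal J \<Longrightarrow> I \<subseteq> J \<Longrightarrow> of_ideal I \<le> of_ideal J"
  by (simp add: of_ideal_le_iff integral_part_of_ideal)

lemma of_ideal_inject: "is_ideal I \<Longrightarrow> is_ideal J \<Longrightarrow> of_ideal I = of_ideal J \<Longrightarrow> I = J"
  by (metis integral_part_of_ideal)

lemma of_ideal_mult:
  assumes "is_ideal I" "is_ideal J"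
  shows "of_ideal (ideal_mult I J) = of_ideal I * of_ideal J"
proof -
  have "of_ideal (ideal_mult I J) \<le> L \<longleftrightarrow> of_ideal I * of_ideal J \<le> L" for L
    unfolding of_ideal_le_iff ideal_mult_def ideal_gen_subset_iff[OF is_ideal_integral_part]
      times_le_iff elts_of_ideal[OF assms(1)] elts_of_ideal[OF assms(2)]
    by (auto simp: frac_ideal_def integral_part_def simp flip: to_fract_mult)
  then show ?thesis by (metis antisym order_refl)
qed

lemma of_ideal_gen_singleton: "of_ideal (ideal_gen {x}) = cyclic (to_fract x)"
proof -
  have "of_ideal (ideal_gen {x}) \<le> L \<longleftrightarrow> cyclic (to_fract x) \<le> L" for L
    unfolding of_ideal_le_iff ideal_gen_subset_iff[OF is_ideal_integral_part]
    by (simp add: integral_part_def)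
  then show ?thesis by (metis antisym order_refl)
qed

lemma of_ideal_nonzero:
  assumes "is_ideal I" "I \<noteq> {0}" shows "of_ideal I \<noteq> 0"
  using assms integral_part_of_ideal[OF assms(1)] by (auto simp: integral_part_def)

lemma frac_mult_elts: "frac_mult (elts M) (elts N) = elts (M * N)"
  by (simp add: frac_mult_def times_submod_def elts_generated)

lemma frac_inverse_elts: "frac_inverse (elts M) = elts (inv_mod M)"
  by (simp add: frac_inverse_def inv_mod_def elts_residual elts_one)

section \<open>Ascending chains and integrality\<close>

text \<open>The union of the chain is an ideal; its finitely many generators all occur at one stage.\<close>

lemma noetherian_chain_stops:
  fixes f :: "nat \<Rightarrow> 'a::idom submod"
  assumes noeth: "noetherian TYPE('a)" and le: "\<And>i. f i \<le> 1" and Suc: "\<And>i. f i \<le> f (Suc i)"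
  shows "\<exists>i. f (Suc i) = f i"
proof -
  define I where "I = (\<Union>i. integral_part (f i))"
  have mono: "f i \<le> f j" if "i \<le> j" for i j
    using that Suc by (rule lift_Suc_mono_le[rotated])
  have add: "\<exists>k. to_fract x + to_fract y \<in> elts (f k)"
    if "to_fract x \<in> elts (f i)" "to_fract y \<in> elts (f j)" for x y i j
    using submod_leD[OF mono[of i "max i j"] that(1)] submod_leD[OF mono[of j "max i j"] that(2)]
    by (auto intro: elts_add)
  have "is_ideal I"
    unfolding I_def is_ideal_iff by (auto simp: integral_part_def add intro: elts_scale)
  then obtain S where S: "finite S" "I = ideal_gen S"
    using noeth unfolding noetherian_def by blast
  have "\<forall>s\<in>S. \<exists>i. s \<in> integral_part (f i)"
    using S ideal_gen_superset[of S] by (auto simp: I_def)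
  then obtain g where g: "\<And>s. s \<in> S \<Longrightarrow> s \<in> integral_part (f (g s))" by metis
  define N where "N = Max (insert 0 (g ` S))"
  have "s \<in> integral_part (f N)" if "s \<in> S" for s
  proof -
    have "g s \<le> N" using that S by (auto simp: N_def)
    then show ?thesis using g[OF that] mono by (auto simp: integral_part_def dest: submod_leD)
  qed
  then have "I \<subseteq> integral_part (f N)"
    unfolding S by (subst ideal_gen_subset_iff) (auto simp: is_ideal_integral_part)
  then have "integral_part (f (Suc N)) \<subseteq> integral_part (f N)"
    by (auto simp: I_def)
  then have "f (Suc N) \<le> f N" using le by (simp add: integral_part_subset_iff)
  then show ?thesis using Suc antisym by blast
qed

lemma noetherian_induct [consumes 2, case_names larger]:
  fixes M :: "'a::idom submod"
  assumes noeth: "noetherian TYPE('a)" and "M \<le> 1"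
    and step: "\<And>M. M \<le> 1 \<Longrightarrow> (\<And>N. M < N \<Longrightarrow> N \<le> 1 \<Longrightarrow> P N) \<Longrightarrow> P M"
  shows "P M"
proof -
  have "wf {(N, M :: 'a submod). M < N \<and> N \<le> 1}"
    unfolding wf_iff_no_infinite_down_chain
  proof
    assume "\<exists>f. \<forall>i. (f (Suc i), f i) \<in> {(N, M :: 'a submod). M < N \<and> N \<le> 1}"
    then obtain f :: "nat \<Rightarrow> 'a submod" where f: "\<And>i. f i < f (Suc i)" "\<And>i. f (Suc i) \<le> 1"
      by auto
    have "\<exists>i. f (Suc (Suc i)) = f (Suc i)"
      using f by (intro noetherian_chain_stops noeth) (auto intro: less_imp_le)
    then show False using f(1) by (metis less_irrefl)
  qed
  then show ?thesis using \<open>M \<le> 1\<close>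
  proof (induction M rule: wf_induct_rule)
    case (less M)
    then show ?case using step by blast
  qed
qed

text \<open>Multiplication by \<open>x \<in> N\<close> preserves \<open>M\<close>, so for a fixed nonzero \<open>c \<in> M\<close> all \<open>c x\<^sup>i\<close> lie in \<open>M \<subseteq> o\<close>. The
  chain of ideals generated by \<open>c, c x, \<dots>, c x\<^sup>i\<close> stops, which expresses some power \<open>x\<^sup>n\<^sup>+\<^sup>1\<close> as an
  \<open>o\<close>-combination of lower ones; thus \<open>x\<close> is integral over \<open>o\<close>.\<close>

lemma stable_imp_integral:
  fixes M N :: "'a::idom submod"
  assumes noeth: "noetherian TYPE('a)" and closed: "integrally_closed TYPE('a)"
    and "M \<le> 1" "M \<noteq> 0" "N * M \<le> M"
  shows "N \<le> 1"
proof (rule submod_leI)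
  fix x assume x: "x \<in> elts N"
  obtain c where c: "c \<in> elts M" "c \<noteq> 0" using \<open>M \<noteq> 0\<close> by (rule submod_nonzeroE)
  have cx: "c * x ^ i \<in> elts M" for i
  proof (induction i)
    case (Suc i)
    have "x * (c * x ^ i) \<in> elts (N * M)" using x Suc by (rule times_elts)
    then show ?case using \<open>N * M \<le> M\<close> by (auto simp: mult_ac dest: submod_leD)
  qed (use c in auto)
  define f where "f i = generated ((\<lambda>j. c * x ^ j) ` {..i})" for i
  have "\<exists>i. f (Suc i) = f i"
  proof (rule noetherian_chain_stops[OF noeth])
    show "f i \<le> 1" for i
      using cx \<open>M \<le> 1\<close> unfolding f_def generated_le_iff by (auto dest: submod_leD)
    show "f i \<le> f (Suc i)" for i
      unfolding f_def generated_le_iff by (auto intro!: generated_base)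
  qed
  then obtain n where n: "f (Suc n) = f n" by blast
  have "c * x ^ Suc n \<in> elts (f (Suc n))"
    unfolding f_def by (intro generated_base imageI) simp
  then have "c * x ^ Suc n \<in> elts (f n)" by (simp only: n)
  moreover have "\<exists>r. y = (\<Sum>j\<le>n. to_fract (r j) * (c * x ^ j))" if "y \<in> elts (f n)" for y
    using that unfolding f_def elts_generated
  proof (induction rule: frac.span_induct_alt)
    case base
    show ?case by (rule exI[of _ "\<lambda>_. 0"]) simp
  next
    case (step d z y)
    then obtain j r where j: "j \<le> n" "z = c * x ^ j"
      and r: "y = (\<Sum>j\<le>n. to_fract (r j) * (c * x ^ j))" by auto
    have "(\<Sum>i\<le>n. to_fract ((if i = j then d else 0) + r i) * (c * x ^ i))
        = (\<Sum>i\<le>n. (if i = j then to_fract d * (c * x ^ i) else 0)) + y"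
      unfolding r sum.distrib[symmetric] by (intro sum.cong) (auto simp: algebra_simps)
    also have "\<dots> = frac_scale d z + y"
      using j by (simp add: frac_scale_def)
    finally show ?case by metis
  qed
  ultimately obtain r where "c * x ^ Suc n = (\<Sum>j\<le>n. to_fract (r j) * (c * x ^ j))"
    by blast
  also have "\<dots> = c * (\<Sum>j\<le>n. to_fract (r j) * x ^ j)"
    by (simp add: sum_distrib_left mult_ac)
  finally have x_eq: "x ^ Suc n = (\<Sum>j\<le>n. to_fract (r j) * x ^ j)"
    using \<open>c \<noteq> 0\<close> by simp
  define q where "q = (\<Sum>j\<le>n. monom (r j) j)"
  define p where "p = monom 1 (Suc n) - q"
  have dq: "degree q < Suc n"
    unfolding q_def by (intro degree_sum_less) (auto intro: le_less_trans[OF degree_monom_le])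
  then have "degree p = Suc n"
    unfolding p_def diff_conv_add_uminus by (subst degree_add_eq_left) (auto simp: degree_monom_eq)
  moreover have "coeff p (Suc n) = 1"
    using coeff_eq_0[OF dq] by (simp add: p_def)
  ultimately have lead: "lead_coeff p = 1" by simp
  have "poly (map_poly to_fract p) x = 0"
  proof -
    have "map_poly to_fract q = (\<Sum>j\<le>n. monom (to_fract (r j)) j)"
      by (rule poly_eqI) (simp add: q_def coeff_map_poly coeff_sum if_distrib cong: if_cong)
    then have "poly (map_poly to_fract q) x = x ^ Suc n"
      by (simp add: poly_sum poly_monom x_eq del: power_Suc)
    moreover have "map_poly to_fract p = monom 1 (Suc n) - map_poly to_fract q"
      by (rule poly_eqI) (simp add: p_def coeff_map_poly)
    ultimately show ?thesis by (simp add: poly_monom)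
  qed
  with lead closed have "x \<in> range to_fract"
    unfolding integrally_closed_def by metis
  then show "x \<in> elts 1" by (simp add: elts_one)
qed

section \<open>Invertibility of ideals in a Dedekind domain\<close>

definition maximal_mod :: "'a::idom submod \<Rightarrow> bool" where
  "maximal_mod P \<longleftrightarrow> P < 1 \<and> (\<forall>N. P < N \<longrightarrow> N \<le> 1 \<longrightarrow> N = 1)"

definition prime_mod :: "'a::idom submod \<Rightarrow> bool" where
  "prime_mod P \<longleftrightarrow> P < 1 \<and> (\<forall>M N. M \<le> 1 \<longrightarrow> N \<le> 1 \<longrightarrow> M * N \<le> P \<longrightarrow> M \<le> P \<or> N \<le> P)"

lemma mult_le_left: "M \<le> L \<Longrightarrow> N \<le> 1 \<Longrightarrow> M * N \<le> (L :: 'a::idom submod)"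
  using submod_mult_mono[of M L N 1] by simp

lemma mult_le_right: "M \<le> L \<Longrightarrow> N \<le> 1 \<Longrightarrow> N * M \<le> (L :: 'a::idom submod)"
  using submod_mult_mono[of N 1 M L] by simp

lemma le_plus [simp]: "M \<le> M + (N :: 'a::idom submod)" "N \<le> M + (N :: 'a::idom submod)"
  using plus_le_iff[of M N "M + N"] by auto

lemma submod_prod_list_le_one:
  "(\<And>M. M \<in> set Ms \<Longrightarrow> M \<le> 1) \<Longrightarrow> prod_list Ms \<le> (1 :: 'a::idom submod)"
  by (induction Ms) (auto intro: mult_le_left)

lemma submod_prod_list_le:
  fixes M :: "'a::idom submod"
  assumes "M \<in> set Ms" "\<And>N. N \<in> set Ms \<Longrightarrow> N \<le> 1"
  shows "prod_list Ms \<le> M"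
proof -
  obtain Us Vs where Ms: "Ms = Us @ M # Vs" using assms(1) by (meson split_list)
  have "M * prod_list (Us @ Vs) \<le> M"
    using assms(2) unfolding Ms by (intro mult_le_left submod_prod_list_le_one) auto
  then show ?thesis by (simp add: Ms mult_ac)
qed

lemma less_plus_iff: "M < M + (N :: 'a::idom submod) \<longleftrightarrow> \<not> N \<le> M"
  by (metis le_plus less_le_not_le order_refl plus_le_iff)

text \<open>If \<open>M\<close> is not contained in the maximal \<open>P\<close>, then \<open>P + M = o\<close>; multiplying by \<open>N\<close> gives \<open>N \<subseteq> P\<close>
  whenever \<open>M N \<subseteq> P\<close>.\<close>

lemma maximal_imp_prime:
  assumes "maximal_mod P" shows "prime_mod P"
proof -
  have P: "P < 1" "\<And>N. P < N \<Longrightarrow> N \<le> 1 \<Longrightarrow> N = 1"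
    using assms by (auto simp: maximal_mod_def)
  have "N \<le> P" if "M \<le> 1" "N \<le> 1" "M * N \<le> P" "\<not> M \<le> P" for M N
  proof -
    have "P + M = 1" using that P by (intro P(2)) (auto simp: less_plus_iff plus_le_iff)
    then have "N = P * N + M * N" by (metis distrib_right mult_1)
    moreover have "P * N + M * N \<le> P" using that by (auto simp: plus_le_iff mult_le_left)
    ultimately show ?thesis by simp
  qed
  then show ?thesis using P(1) by (auto simp: prime_mod_def)
qed

lemma prime_prod_list_le:
  assumes "prime_mod P" "prod_list Ms \<le> P" "\<And>M. M \<in> set Ms \<Longrightarrow> M \<le> 1"
  shows "\<exists>M\<in>set Ms. M \<le> P"
  using assms(2,3)
proof (induction Ms)
  case Nil
  then show ?case using assms(1) by (auto simp: prime_mod_def)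
next
  case (Cons M Ms)
  have "prod_list Ms \<le> 1"
    using Cons.prems(2) by (intro submod_prod_list_le_one) auto
  then have "M \<le> P \<or> prod_list Ms \<le> P"
    using Cons.prems assms(1) by (auto simp: prime_mod_def)
  then show ?case using Cons by auto
qed

locale dedekind =
  fixes ring :: "'a::idom itself"
  assumes dedekind: "dedekind_domain ring"
begin

lemma noeth: "noetherian TYPE('a)" and closed: "integrally_closed TYPE('a)"
  using dedekind by (simp_all add: dedekind_domain_def noetherian_def integrally_closed_def)

lemma prime_imp_maximal:
  fixes P :: "'a submod"
  assumes P: "prime_mod P" "P \<noteq> 0"
  shows "maximal_mod P"
proof -
  have P1: "P < 1" "P \<le> 1" using P by (auto simp: prime_mod_def)
  have UNIV_iff: "integral_part N = UNIV \<longleftrightarrow> 1 \<le> N" for N :: "'a submod"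
    using integral_part_subset_iff[of 1 N] by (auto simp: integral_part_def elts_one)
  have "x \<in> integral_part P \<or> y \<in> integral_part P" if "x * y \<in> integral_part P" for x y
  proof -
    have "cyclic (to_fract x) * cyclic (to_fract y) \<le> P"
      using that by (simp add: cyclic_mult integral_part_def)
    moreover have "cyclic (to_fract r) \<le> 1" for r :: 'a by (simp add: elts_one)
    ultimately have "cyclic (to_fract x) \<le> P \<or> cyclic (to_fract y) \<le> P"
      using P(1) unfolding prime_mod_def by blast
    then show ?thesis by (simp add: integral_part_def)
  qed
  moreover have "integral_part P \<noteq> UNIV" using P1 by (auto simp: UNIV_iff)
  moreover have "integral_part P \<noteq> {0}"
  proof
    assume *: "integral_part P = {0}"
    obtain x where x: "x \<in> elts P" "x \<noteq> 0" using P(2) by (rule submod_nonzeroE)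
    then obtain r where r: "x = to_fract r" using elts_le_one[OF P1(2)] by blast
    with x have "r \<in> integral_part P" by (simp add: integral_part_def)
    with * r x show False by simp
  qed
  ultimately have "maximal_ideal (integral_part P)"
    using dedekind is_ideal_integral_part
    unfolding dedekind_domain_def prime_ideal_def by blast
  then have max: "J = integral_part P \<or> J = UNIV" if "is_ideal J" "integral_part P \<subseteq> J" for J
    using that by (simp add: maximal_ideal_def)
  have "N = 1" if "P < N" "N \<le> 1" for N
  proof -
    have "integral_part P \<subseteq> integral_part N"
      using that P1 by (subst integral_part_subset_iff) auto
    then have "integral_part N = integral_part P \<or> integral_part N = UNIV"
      by (intro max is_ideal_integral_part)
    moreover have "integral_part N \<noteq> integral_part P"
      using that integral_part_subset_iff[of N P] by (metis leD order_refl)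
    ultimately show "N = 1" using that UNIV_iff by (metis antisym)
  qed
  then show ?thesis using P1 by (simp add: maximal_mod_def)
qed

lemma ex_maximal:
  fixes M :: "'a submod"
  assumes "M < 1"
  shows "\<exists>P. maximal_mod P \<and> M \<le> P"
proof -
  have "M \<le> 1" using assms by simp
  with noeth show ?thesis using assms
  proof (induction rule: noetherian_induct)
    case (larger M)
    show ?case
    proof (cases "maximal_mod M")
      case False
      then obtain N where "M < N" "N < 1" using larger by (auto simp: maximal_mod_def less_le)
      then show ?thesis using larger(2)[of N] by (meson less_imp_le order_trans)
    qed auto
  qed
qed

text \<open>Noetherian induction: an ideal that is neither prime nor the whole ring contains a product
  \<open>(M + A) (M + B)\<close> of two strictly larger ideals. The whole ring is the empty product.\<close>

lemma ex_prod_maximal_le: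
  fixes M :: "'a submod"
  assumes "M \<le> 1" "M \<noteq> 0"
  shows "\<exists>Ps. (\<forall>P\<in>set Ps. maximal_mod P) \<and> prod_list Ps \<le> M"
  using noeth assms
proof (induction rule: noetherian_induct)
  case (larger M)
  consider "M = 1" | "prime_mod M" | A B where "A \<le> 1" "B \<le> 1" "A * B \<le> M" "\<not> A \<le> M" "\<not> B \<le> M"
    using larger(1) unfolding prime_mod_def by (metis less_le)
  then show ?case
  proof cases
    case 1
    then show ?thesis by (intro exI[of _ "[]"]) simp
  next
    case 2
    then show ?thesis using prime_imp_maximal larger by (intro exI[of _ "[M]"]) auto
  next
    case 3
    have "M + A \<noteq> 0" "M + B \<noteq> 0"
      using larger(3) le_plus(1)[of M] submod_zero_le by (metis antisym)+
    then obtain Ps Qs where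
      "\<forall>P\<in>set Ps. maximal_mod P" "prod_list Ps \<le> M + A"
      "\<forall>P\<in>set Qs. maximal_mod P" "prod_list Qs \<le> M + B"
      using larger(2)[of "M + A"] larger(2)[of "M + B"] larger(1) 3
      by (auto simp: less_plus_iff plus_le_iff)
    moreover have "(M + A) * (M + B) \<le> M"
      using 3 larger(1) by (auto simp: distrib_left distrib_right plus_le_iff mult_le_left mult_le_right)
    ultimately show ?thesis
      using submod_mult_mono[of "prod_list Ps" "M + A" "prod_list Qs" "M + B"]
      by (intro exI[of _ "Ps @ Qs"]) auto
  qed
qed

lemma maximal_le_one: "maximal_mod P \<Longrightarrow> P \<le> 1"
  by (auto simp: maximal_mod_def)

lemma prod_maximal_le_maximal:
  assumes "maximal_mod P" "\<forall>Q\<in>set Qs. maximal_mod Q" "prod_list Qs \<le> P"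
  shows "P \<in> set Qs"
proof -
  obtain Q where Q: "Q \<in> set Qs" "Q \<le> P"
    using prime_prod_list_le[OF maximal_imp_prime[OF assms(1)] assms(3)] assms(2) maximal_le_one
    by blast
  then have "Q = P" using assms unfolding maximal_mod_def by (metis less_le less_irrefl)
  with Q show ?thesis by simp
qed

text \<open>Choose a shortest product \<open>P P\<^sub>2\<cdots>P\<^sub>r\<close> of maximal ideals inside a principal ideal \<open>(a) \<subseteq> P\<close>. Some
  \<open>b \<in> P\<^sub>2\<cdots>P\<^sub>r\<close> lies outside \<open>(a)\<close> by minimality, and then \<open>b / a\<close> is a nonintegral element with
  \<open>(b / a) P \<subseteq> o\<close>.\<close>

lemma inv_maximal_not_integral:
  fixes P :: "'a submod"
  assumes P: "maximal_mod P" "P \<noteq> 0"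
  shows "\<not> inv_mod P \<le> 1"
proof
  assume inv: "inv_mod P \<le> 1"
  obtain a where a: "a \<in> elts P" "a \<noteq> 0" using P(2) by (rule submod_nonzeroE)
  define good where "good Ps \<longleftrightarrow> (\<forall>Q\<in>set Ps. maximal_mod Q) \<and> prod_list Ps \<le> cyclic a" for Ps
  have "cyclic a \<le> P" using a by simp
  moreover have "cyclic a \<noteq> 0" using a by (metis cyclic_self elts_zero singletonD)
  ultimately have "\<exists>Ps. good Ps"
    unfolding good_def using ex_prod_maximal_le maximal_le_one[OF P(1)] by (meson order_trans)
  then obtain Ps where Ps: "good Ps" and min: "\<And>Qs. good Qs \<Longrightarrow> length Ps \<le> length Qs"
    by (metis ex_has_least_nat)
  have "prod_list Ps \<le> P" using Ps \<open>cyclic a \<le> P\<close> unfolding good_def by (metis order_trans)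
  then have "P \<in> set Ps" using P Ps by (intro prod_maximal_le_maximal) (auto simp: good_def)
  then obtain Us Vs where split: "Ps = Us @ P # Vs" by (meson split_list)
  have "\<not> good (Us @ Vs)" using min[of "Us @ Vs"] split by auto
  then have "\<not> prod_list (Us @ Vs) \<le> cyclic a" using Ps split by (auto simp: good_def)
  then obtain b where b: "b \<in> elts (prod_list (Us @ Vs))" "b \<notin> elts (cyclic a)"
    by (meson submod_leI)
  have "cyclic b * P \<le> prod_list (Us @ Vs) * P"
    using b by (intro submod_mult_right_mono) simp
  also have "\<dots> = prod_list Ps" by (simp add: split mult_ac)
  also have "\<dots> \<le> cyclic a" using Ps by (simp add: good_def)
  finally have "cyclic (inverse a) * (cyclic b * P) \<le> cyclic (inverse a) * cyclic a"
    by (rule submod_mult_left_mono)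
  moreover have "cyclic (inverse a) * cyclic a = 1" using a by (simp add: cyclic_mult)
  ultimately have "cyclic (inverse a * b) \<le> inv_mod P"
    unfolding le_inv_mod_iff by (simp add: mult.assoc flip: cyclic_mult)
  then have "cyclic a * cyclic (inverse a * b) \<le> cyclic a * 1"
    using inv by (intro submod_mult_left_mono) (rule order_trans)
  then show False using a b by (simp add: cyclic_mult flip: mult.assoc)
qed

text \<open>Noetherian induction on \<open>M\<close>. The ideal \<open>N = M\<inverse> M\<close> contains \<open>M\<close>. Equality would make \<open>M\<inverse>\<close> integral
  by \<open>stable_imp_integral\<close>, although it contains the nonintegral module \<open>P\<inverse>\<close> for a maximal
  \<open>P \<supseteq> M\<close>. So \<open>N\<close> is strictly larger, hence invertible, and therefore \<open>M\<close> is invertible too.\<close>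

lemma ideal_invertible:
  fixes M :: "'a submod"
  assumes "M \<le> 1" "M \<noteq> 0"
  shows "invertible_mod M"
  using noeth assms
proof (induction rule: noetherian_induct)
  case (larger M)
  show ?case
  proof (cases "M = 1")
    case False
    then obtain P where P: "maximal_mod P" "M \<le> P" using ex_maximal[of M] larger(1) by (auto simp: less_le)
    have "P \<noteq> 0" using P larger(3) by (metis antisym submod_zero_le)
    have "inv_mod P * M \<le> inv_mod P * P" using P(2) by (rule submod_mult_left_mono)
    also have "\<dots> \<le> 1" by (simp flip: le_inv_mod_iff)
    finally have "inv_mod P \<le> inv_mod M" by (simp add: le_inv_mod_iff)
    then have not: "\<not> inv_mod M \<le> 1"
      using inv_maximal_not_integral[OF P(1) \<open>P \<noteq> 0\<close>] by (meson order_trans)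
    define N where "N = inv_mod M * M"
    have "N \<le> 1" by (simp add: N_def flip: le_inv_mod_iff)
    have "1 * M \<le> N"
      unfolding N_def using larger(1) by (intro submod_mult_right_mono) (simp add: le_inv_mod_iff)
    moreover have "\<not> N \<le> M"
      using stable_imp_integral[OF noeth closed larger(1,3), of "inv_mod M"] not by (auto simp: N_def)
    ultimately have "M < N" by (auto simp: less_le_not_le)
    moreover have "N \<noteq> 0" using \<open>M < N\<close> by (metis leD submod_zero_le)
    ultimately have "invertible_mod N" using larger(2) \<open>N \<le> 1\<close> by blast
    then have "M * (inv_mod M * inv_mod N) = 1"
      using invertible_inv(1)[of N] by (simp add: N_def mult_ac)
    then show ?thesis by (rule invertibleI)
  qed simp
qed

text \<open>Prime avoidance inside \<open>J\<close>, one prime at a time: if the element found so far fails only at \<open>P\<close>, add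
  an element of \<open>P\<^sub>1\<cdots>P\<^sub>r J\<close> outside \<open>P J\<close>, which changes nothing modulo the earlier \<open>P\<^sub>i J\<close>.\<close>

lemma ex_avoiding_element:
  fixes J :: "'a submod"
  assumes J: "invertible_mod J" and "\<forall>P\<in>set Ps. maximal_mod P"
  shows "\<exists>y\<in>elts J. \<forall>P\<in>set Ps. y \<notin> elts (P * J)"
  using assms(2)
proof (induction Ps)
  case Nil
  show ?case by (auto intro!: exI[of _ 0])
next
  case (Cons P Ps)
  then obtain y where y: "y \<in> elts J" "\<And>Q. Q \<in> set Ps \<Longrightarrow> y \<notin> elts (Q * J)" by auto
  have cancel: "M * J \<le> N * J \<longleftrightarrow> M \<le> N" for M N
    using invertible_le_iff[OF J, of M N] by (simp add: mult.commute)
  have Ps1: "prod_list Ps \<le> 1"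
    using Cons.prems by (intro submod_prod_list_le_one) (auto simp: maximal_le_one)
  have member: "prod_list Ps \<le> Q" if "Q \<in> set Ps" for Q
    using that Cons.prems by (intro submod_prod_list_le) (auto simp: maximal_le_one)
  show ?case
  proof (cases "P \<in> set Ps \<or> y \<notin> elts (P * J)")
    case True
    then show ?thesis using y by auto
  next
    case False
    have "\<not> prod_list Ps \<le> P"
      using prod_maximal_le_maximal[of P Ps] Cons.prems False by auto
    then obtain z where z: "z \<in> elts (prod_list Ps * J)" "z \<notin> elts (P * J)"
      using cancel by (meson submod_leI)
    have "y + z \<notin> elts (P * J)"
      using False z(2) elts_diff[of "y + z" "P * J" y] by auto
    moreover have "y + z \<notin> elts (Q * J)" if "Q \<in> set Ps" for Q
    proof -
      have "z \<in> elts (Q * J)" using z(1) member[OF that] cancel by (meson submod_leD)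
      then show ?thesis using y(2)[OF that] elts_diff[of "y + z" "Q * J" z] by auto
    qed
    moreover have "z \<in> elts J"
      using z(1) Ps1 cancel[of "prod_list Ps" 1] by (auto dest: submod_leD)
    ultimately show ?thesis using y(1) by (intro bexI[of _ "y + z"]) (auto intro: elts_add)
  qed
qed

text \<open>Take any nonzero \<open>x \<in> I\<close>. Only finitely many maximal ideals contain \<open>x I\<inverse>\<close>, namely some of the factors
  of a product of maximal ideals below it. An element \<open>y \<in> J\<close> outside all \<open>P J\<close> for these \<open>P\<close> makes
  \<open>y J\<inverse>\<close> lie in none of them.\<close>

lemma ex_comaximal_elements:
  fixes I J :: "'a submod"
  assumes I: "invertible_mod I" and J: "invertible_mod J"
  shows "\<exists>x\<in>elts I. \<exists>y\<in>elts J. cyclic x * inv_mod I + cyclic y * inv_mod J = 1"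
proof -
  have "I \<noteq> 0" using I by (auto simp: invertible_mod_def)
  then obtain x where x: "x \<in> elts I" "x \<noteq> 0" by (rule submod_nonzeroE)
  define M where "M = cyclic x * inv_mod I"
  have le: "cyclic z * inv_mod K \<le> 1" if "invertible_mod K" "z \<in> elts K" for z and K :: "'a submod"
    using submod_mult_right_mono[of "cyclic z" K "inv_mod K"] that by simp
  have "M \<le> 1" using le[OF I x(1)] by (simp add: M_def)
  moreover have "invertible_mod M"
    using I x(2) by (simp add: M_def invertible_cyclic)
  then have "M \<noteq> 0" by (auto simp: invertible_mod_def)
  ultimately obtain Ps where Ps: "\<forall>P\<in>set Ps. maximal_mod P" "prod_list Ps \<le> M"
    using ex_prod_maximal_le by blast
  obtain y where y: "y \<in> elts J" "\<And>P. P \<in> set Ps \<Longrightarrow> y \<notin> elts (P * J)"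
    using ex_avoiding_element[OF J Ps(1)] by blast
  define K where "K = M + cyclic y * inv_mod J"
  have "K \<le> 1" using \<open>M \<le> 1\<close> le[OF J y(1)] by (simp add: K_def plus_le_iff)
  moreover have "\<not> K < 1"
  proof
    assume "K < 1"
    then obtain P where P: "maximal_mod P" "K \<le> P" using ex_maximal by blast
    have "P \<in> set Ps"
      using Ps P by (intro prod_maximal_le_maximal) (auto simp: K_def plus_le_iff)
    moreover have "cyclic y * inv_mod J * J \<le> P * J"
      using P(2) by (intro submod_mult_right_mono) (simp add: K_def plus_le_iff)
    then have "y \<in> elts (P * J)" using J by (simp add: mult.assoc)
    ultimately show False using y(2) by blast
  qed
  ultimately have "K = 1" by auto
  then show ?thesis using x y unfolding K_def M_def by blast
qed

end

section \<open>Direct sums of invertible modules and Steinitz's theorem\<close>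

lemma times_mat_index:
  assumes "X \<in> carrier_mat n n" "Y \<in> carrier_mat n n" "i < n" "j < n"
  shows "(X * Y) $$ (i, j) = (\<Sum>l<n. X $$ (i, l) * Y $$ (l, j))"
  using assms by (auto simp: scalar_prod_def lessThan_atLeast0 intro!: sum.cong)

text \<open>Matrices of the \<open>o\<close>-linear maps \<open>\<delta>\<^sub>0 \<oplus> \<dots> \<oplus> \<delta>\<^sub>n\<^sub>-\<^sub>1 \<rightarrow> \<gamma>\<^sub>0 \<oplus> \<dots> \<oplus> \<gamma>\<^sub>n\<^sub>-\<^sub>1\<close> for invertible \<open>\<delta>\<^sub>i\<close>.\<close>

definition hom_mats ::
    "nat \<Rightarrow> (nat \<Rightarrow> 'a::idom submod) \<Rightarrow> (nat \<Rightarrow> 'a submod) \<Rightarrow> 'a fract mat set" where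
  "hom_mats n \<delta> \<gamma> =
     {X \<in> carrier_mat n n. \<forall>i<n. \<forall>j<n. X $$ (i, j) \<in> elts (\<gamma> i * inv_mod (\<delta> j))}"

lemma hom_mats_carrier: "X \<in> hom_mats n \<delta> \<gamma> \<Longrightarrow> X \<in> carrier_mat n n"
  by (simp add: hom_mats_def)

lemma hom_mats_index: "X \<in> hom_mats n \<delta> \<gamma> \<Longrightarrow> i < n \<Longrightarrow> j < n \<Longrightarrow> X $$ (i, j) \<in> elts (\<gamma> i * inv_mod (\<delta> j))"
  by (simp add: hom_mats_def)

lemma times_hom_mats:
  assumes X: "X \<in> hom_mats n \<delta> \<gamma>" and Y: "Y \<in> hom_mats n \<epsilon> \<delta>"
    and inv: "\<And>i. i < n \<Longrightarrow> invertible_mod (\<delta> i)"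
  shows "X * Y \<in> hom_mats n \<epsilon> \<gamma>"
proof -
  have "(X * Y) $$ (i, j) \<in> elts (\<gamma> i * inv_mod (\<epsilon> j))" if ij: "i < n" "j < n" for i j
    unfolding times_mat_index[OF hom_mats_carrier[OF X] hom_mats_carrier[OF Y] ij]
  proof (rule elts_sum)
    fix l assume l: "l \<in> {..<n}"
    then have "X $$ (i, l) * Y $$ (l, j) \<in> elts ((\<gamma> i * inv_mod (\<delta> l)) * (\<delta> l * inv_mod (\<epsilon> j)))"
      using ij by (intro times_elts hom_mats_index[OF X] hom_mats_index[OF Y]) auto
    also have "(\<gamma> i * inv_mod (\<delta> l)) * (\<delta> l * inv_mod (\<epsilon> j)) = \<gamma> i * inv_mod (\<epsilon> j)"
      using l inv by (simp add: mult.assoc)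
    finally show "X $$ (i, l) * Y $$ (l, j) \<in> elts (\<gamma> i * inv_mod (\<epsilon> j))" .
  qed
  then show ?thesis using X Y by (auto simp: hom_mats_def)
qed

text \<open>Since the matrices are square over a field, the one-sided condition makes \<open>X\<close> and \<open>X'\<close> mutually
  inverse.\<close>

definition isomorphic_sums :: "nat \<Rightarrow> (nat \<Rightarrow> 'a::idom submod) \<Rightarrow> (nat \<Rightarrow> 'a submod) \<Rightarrow> bool" where
  "isomorphic_sums n \<delta> \<gamma> \<longleftrightarrow> (\<exists>X\<in>hom_mats n \<delta> \<gamma>. \<exists>X'\<in>hom_mats n \<gamma> \<delta>. X * X' = 1\<^sub>m n)"

lemma isomorphic_sums_trans:
  assumes "isomorphic_sums n \<epsilon> \<delta>" "isomorphic_sums n \<delta> \<gamma>"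
    and inv: "\<And>i. i < n \<Longrightarrow> invertible_mod (\<delta> i)"
  shows "isomorphic_sums n \<epsilon> \<gamma>"
proof -
  obtain X X' where X: "X \<in> hom_mats n \<delta> \<gamma>" "X' \<in> hom_mats n \<gamma> \<delta>" "X * X' = 1\<^sub>m n"
    using assms(2) by (auto simp: isomorphic_sums_def)
  obtain Y Y' where Y: "Y \<in> hom_mats n \<epsilon> \<delta>" "Y' \<in> hom_mats n \<delta> \<epsilon>" "Y * Y' = 1\<^sub>m n"
    using assms(1) by (auto simp: isomorphic_sums_def)
  note [simp] = X(1,2)[THEN hom_mats_carrier] Y(1,2)[THEN hom_mats_carrier]
  have "(X * Y) * (Y' * X') = X * ((Y * Y') * X')"
    by (simp add: assoc_mult_mat[where n\<^sub>1=n and n\<^sub>2=n and n\<^sub>3=n and n\<^sub>4=n] mult_carrier_mat[where nr=n and n=n and nc=n])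
  also have "\<dots> = 1\<^sub>m n" using X(3) Y(3) left_mult_one_mat[of X' n n] by simp
  finally show ?thesis
    unfolding isomorphic_sums_def using times_hom_mats[OF X(1) Y(1)] times_hom_mats[OF Y(2) X(2)] inv
    by blast
qed

lemma isomorphic_sums_refl:
  assumes "\<And>i. i < n \<Longrightarrow> invertible_mod (\<gamma> i)" "\<And>i. i < n \<Longrightarrow> \<delta> i = \<gamma> i"
  shows "isomorphic_sums n \<delta> \<gamma>"
proof -
  have "1\<^sub>m n \<in> hom_mats n \<delta> \<gamma>" "1\<^sub>m n \<in> hom_mats n \<gamma> \<delta>"
    using assms by (auto simp: hom_mats_def)
  moreover have "1\<^sub>m n * 1\<^sub>m n = (1\<^sub>m n :: 'a fract mat)" by (rule left_mult_one_mat[OF one_carrier_mat])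
  ultimately show ?thesis unfolding isomorphic_sums_def by blast
qed

context dedekind
begin

text \<open>Steinitz's isomorphism \<open>I \<oplus> J \<cong> o \<oplus> I J\<close>, applied to the summands \<open>m\<close> and \<open>m + 1\<close>. With \<open>x \<in> I\<close>, \<open>y \<in> J\<close>,
  \<open>v \<in> I\<inverse>\<close>, \<open>u \<in> J\<inverse>\<close> and \<open>x v + y u = 1\<close>, the matrix with rows \<open>(x, -u)\<close> and \<open>(y, v)\<close> has determinant \<open>1\<close>,
  maps \<open>o \<oplus> I J\<close> into \<open>I \<oplus> J\<close>, and its adjugate maps back.\<close>

lemma isomorphic_sums_merge:
  fixes \<delta> :: "nat \<Rightarrow> 'a submod"
  assumes m: "Suc m < n" and inv: "\<And>i. i < n \<Longrightarrow> invertible_mod (\<delta> i)"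
  shows "isomorphic_sums n (\<delta>(m := 1, Suc m := \<delta> m * \<delta> (Suc m))) \<delta>"
proof -
  have invs [simp]: "invertible_mod (\<delta> m)" "invertible_mod (\<delta> (Suc m))" using m inv by auto
  let ?\<delta> = "\<delta>(m := 1, Suc m := \<delta> m * \<delta> (Suc m))"
  obtain x y where x: "x \<in> elts (\<delta> m)" and y: "y \<in> elts (\<delta> (Suc m))"
    and xy: "cyclic x * inv_mod (\<delta> m) + cyclic y * inv_mod (\<delta> (Suc m)) = 1"
    using ex_comaximal_elements[OF invs] by blast
  have "1 \<in> elts (cyclic x * inv_mod (\<delta> m) + cyclic y * inv_mod (\<delta> (Suc m)))"
    by (simp add: xy)
  then obtain p q where "1 = p + q" "p \<in> elts (cyclic x * inv_mod (\<delta> m))"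
      "q \<in> elts (cyclic y * inv_mod (\<delta> (Suc m)))"
    unfolding elts_plus by blast
  then obtain u v where u: "u \<in> elts (inv_mod (\<delta> (Suc m)))" and v: "v \<in> elts (inv_mod (\<delta> m))"
    and det: "x * v + y * u = 1"
    using elts_cyclic_times by metis
  \<comment> \<open>The identity matrix with the given two-by-two block in rows and columns m and m + 1.\<close>
  define block where "block a b c d = mat n n (\<lambda>(i, j).
      if i = m \<and> j = m then a else if i = m \<and> j = Suc m then b
      else if i = Suc m \<and> j = m then c else if i = Suc m \<and> j = Suc m then d
      else if i = j then 1 else 0)" for a b c d :: "'a fract"
  have carrier: "block a b c d \<in> carrier_mat n n" for a b c d by (simp add: block_def)
  have "block x (- u) y v * block v u (- y) x = 1\<^sub>m n"
  proof (rule eq_matI)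
    fix i j assume "i < dim_row (1\<^sub>m n :: 'a fract mat)" "j < dim_col (1\<^sub>m n :: 'a fract mat)"
    then have ij: "i < n" "j < n" by auto
    have "(block x (- u) y v * block v u (- y) x) $$ (i, j)
        = (\<Sum>l<n. block x (- u) y v $$ (i, l) * block v u (- y) x $$ (l, j))"
      using carrier ij by (rule times_mat_index[OF carrier])
    also have "\<dots> = (\<Sum>l\<in>(if i = m \<or> i = Suc m then {m, Suc m} else {i}).
        block x (- u) y v $$ (i, l) * block v u (- y) x $$ (l, j))"
      using ij m by (intro sum.mono_neutral_right) (auto simp: block_def)
    also have "\<dots> = 1\<^sub>m n $$ (i, j)"
      using det ij m by (auto simp: block_def algebra_simps)
    finally show "(block x (- u) y v * block v u (- y) x) $$ (i, j) = 1\<^sub>m n $$ (i, j)" .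
  qed (simp_all add: block_def)
  moreover have "block x (- u) y v \<in> hom_mats n ?\<delta> \<delta>"
  proof -
    have "\<delta> m * inv_mod (\<delta> m * \<delta> (Suc m)) = inv_mod (\<delta> (Suc m))"
      by (simp add: inv_mod_mult)
    moreover have "\<delta> (Suc m) * inv_mod (\<delta> m * \<delta> (Suc m)) = inv_mod (\<delta> m)"
      by (simp add: inv_mod_mult mult.commute[of "inv_mod (\<delta> m)"])
    ultimately show ?thesis
      using x y u v inv by (auto simp: hom_mats_def block_def elts_uminus)
  qed
  moreover have "block v u (- y) x \<in> hom_mats n \<delta> ?\<delta>"
  proof -
    have "\<delta> m * \<delta> (Suc m) * inv_mod (\<delta> m) = \<delta> (Suc m)"
      by (simp add: mult.commute[of "\<delta> m"] mult.assoc)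
    moreover have "\<delta> m * \<delta> (Suc m) * inv_mod (\<delta> (Suc m)) = \<delta> m"
      by (simp add: mult.assoc)
    ultimately show ?thesis
      using x y u v inv by (auto simp: hom_mats_def block_def elts_uminus)
  qed
  ultimately show ?thesis unfolding isomorphic_sums_def by blast
qed

lemma isomorphic_sums_collect:
  fixes \<gamma> :: "nat \<Rightarrow> 'a submod"
  assumes "m < n" and inv: "\<And>i. i < n \<Longrightarrow> invertible_mod (\<gamma> i)"
  shows "isomorphic_sums n (\<lambda>i. if i < m then 1 else if i = m then \<Prod>j\<le>m. \<gamma> j else \<gamma> i) \<gamma>"
  using assms(1)
proof (induction m)
  case 0
  then show ?case using inv by (intro isomorphic_sums_refl) auto
next
  case (Suc m)
  define \<delta> where "\<delta> = (\<lambda>i. if i < m then 1 else if i = m then \<Prod>j\<le>m. \<gamma> j else \<gamma> i)"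
  have \<delta>: "invertible_mod (\<delta> i)" if "i < n" for i
    using that inv by (auto simp: \<delta>_def intro!: invertible_prod)
  have "(\<lambda>i. if i < Suc m then 1 else if i = Suc m then \<Prod>j\<le>Suc m. \<gamma> j else \<gamma> i)
      = \<delta>(m := 1, Suc m := \<delta> m * \<delta> (Suc m))"
    by (auto simp: \<delta>_def fun_eq_iff)
  then show ?case
    using isomorphic_sums_trans[OF isomorphic_sums_merge[OF Suc.prems \<delta>] Suc.IH[folded \<delta>_def] \<delta>] Suc.prems
    by simp
qed

text \<open>Merging the summands from left to right leads to \<open>o \<oplus> \<dots> \<oplus> o \<oplus> \<Prod>\<gamma>\<^sub>i\<close>, and the last summand is free
  because it is principal.\<close>

lemma steinitz_free:
  fixes \<gamma> :: "nat \<Rightarrow> 'a submod"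
  assumes n: "n \<ge> 1" and inv: "\<And>i. i < n \<Longrightarrow> invertible_mod (\<gamma> i)"
    and g: "(\<Prod>i<n. \<gamma> i) = cyclic g"
  shows "isomorphic_sums n (\<lambda>_. 1) \<gamma>"
proof -
  obtain m where m: "n = Suc m" using n by (cases n) auto
  have "invertible_mod (cyclic g)" using inv by (auto simp flip: g intro!: invertible_prod)
  then have "g \<noteq> 0" by (auto simp: invertible_mod_def)
  define \<delta> where "\<delta> = (\<lambda>i. if i < m then 1 else if i = m then \<Prod>j\<le>m. \<gamma> j else \<gamma> i)"
  have \<delta>: "\<delta> i = (if i < m then 1 else cyclic g)" if "i < n" for i
    using that g m by (auto simp: \<delta>_def lessThan_Suc_atMost)
  have inv_\<delta>: "invertible_mod (\<delta> i)" if "i < n" for i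
    using \<delta>[OF that] \<open>invertible_mod (cyclic g)\<close> by simp
  have inv_g: "inv_mod (cyclic g) = cyclic (inverse g)"
    using \<open>g \<noteq> 0\<close> by (intro inv_mod_unique cyclic_times_inverse)
  define D where "D h = mat n n (\<lambda>(i, j). if i = j then if i < m then 1 else h else (0 :: 'a fract))" for h
  have "D g * D (inverse g) = 1\<^sub>m n"
  proof (rule eq_matI)
    fix i j assume "i < dim_row (1\<^sub>m n :: 'a fract mat)" "j < dim_col (1\<^sub>m n :: 'a fract mat)"
    then have ij: "i < n" "j < n" by auto
    have "(D g * D (inverse g)) $$ (i, j) = (\<Sum>l<n. D g $$ (i, l) * D (inverse g) $$ (l, j))"
      using ij by (intro times_mat_index) (auto simp: D_def)
    also have "\<dots> = (\<Sum>l\<in>{i}. D g $$ (i, l) * D (inverse g) $$ (l, j))"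
      using ij by (intro sum.mono_neutral_right) (auto simp: D_def)
    also have "\<dots> = 1\<^sub>m n $$ (i, j)"
      using ij \<open>g \<noteq> 0\<close> by (auto simp: D_def)
    finally show "(D g * D (inverse g)) $$ (i, j) = 1\<^sub>m n $$ (i, j)" .
  qed (simp_all add: D_def)
  moreover have "D g \<in> hom_mats n (\<lambda>_. 1) \<delta>" "D (inverse g) \<in> hom_mats n \<delta> (\<lambda>_. 1)"
    using \<delta> by (auto simp: hom_mats_def D_def inv_g)
  ultimately have "isomorphic_sums n (\<lambda>_. 1) \<delta>"
    unfolding isomorphic_sums_def by blast
  then show ?thesis
    using isomorphic_sums_trans isomorphic_sums_collect[of m n \<gamma>] inv inv_\<delta> m
    unfolding \<delta>_def by blast
qed

end

section \<open>Minors and determinants of products\<close>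

text \<open>Multilinearity in the rows, without collecting the terms into minors as in the Cauchy--Binet
  formula: the index maps \<open>f\<close> may be unordered or have repetitions. In this form each factor
  \<open>P i (f i)\<close> can be estimated separately.\<close>

lemma det_mat_sum_rows:
  fixes P Q :: "nat \<Rightarrow> nat \<Rightarrow> 'a::comm_ring_1"
  shows "det (mat k k (\<lambda>(i, j). \<Sum>l<n. P i l * Q l j))
    = (\<Sum>f\<in>{..<k} \<rightarrow>\<^sub>E {..<n}. (\<Prod>i<k. P i (f i)) * det (mat k k (\<lambda>(i, j). Q (f i) j)))"
proof -
  have mem: "p i < k" if "p permutes {0..<k}" "i < k" for p i
    using permutes_in_image[OF that(1), of i] that(2) by simp
  have expand: "det (mat k k (\<lambda>(i, j). A i j)) = (\<Sum>p | p permutes {0..<k}. signof p * (\<Prod>i<k. A i (p i)))"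
    for A :: "nat \<Rightarrow> nat \<Rightarrow> 'a"
    by (subst det_def'[where n = k]) (auto simp: mem lessThan_atLeast0 intro!: sum.cong prod.cong)
  have "det (mat k k (\<lambda>(i, j). \<Sum>l<n. P i l * Q l j))
      = (\<Sum>p | p permutes {0..<k}. signof p *
          (\<Sum>f\<in>{..<k} \<rightarrow>\<^sub>E {..<n}. (\<Prod>i<k. P i (f i)) * (\<Prod>i<k. Q (f i) (p i))))"
    unfolding expand by (subst prod_sum_PiE) (simp_all add: prod.distrib)
  also have "\<dots> = (\<Sum>f\<in>{..<k} \<rightarrow>\<^sub>E {..<n}. \<Sum>p | p permutes {0..<k}.
          (\<Prod>i<k. P i (f i)) * (signof p * (\<Prod>i<k. Q (f i) (p i))))"
    unfolding sum_distrib_left by (subst sum.swap) (simp add: mult_ac)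
  also have "\<dots> = (\<Sum>f\<in>{..<k} \<rightarrow>\<^sub>E {..<n}. (\<Prod>i<k. P i (f i)) * det (mat k k (\<lambda>(i, j). Q (f i) j)))"
    unfolding expand sum_distrib_left ..
  finally show ?thesis .
qed

lemma det_mat_swap: "det (mat k k (\<lambda>(i, j). A j i)) = det (mat k k (\<lambda>(i, j). A i j))"
proof -
  have "mat k k (\<lambda>(i, j). A j i) = transpose_mat (mat k k (\<lambda>(i, j). A i j))"
    by (rule eq_matI) auto
  then show ?thesis by (simp add: det_transpose[where n = k])
qed

lemma det_mat_sum_cols:
  fixes P Q :: "nat \<Rightarrow> nat \<Rightarrow> 'a::comm_ring_1"
  shows "det (mat k k (\<lambda>(i, j). \<Sum>l<n. P i l * Q l j))
    = (\<Sum>g\<in>{..<k} \<rightarrow>\<^sub>E {..<n}. det (mat k k (\<lambda>(i, j). P i (g j))) * (\<Prod>j<k. Q (g j) j))"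
proof -
  have "det (mat k k (\<lambda>(i, j). \<Sum>l<n. P i l * Q l j)) = det (mat k k (\<lambda>(i, j). \<Sum>l<n. Q l i * P j l))"
    by (subst det_mat_swap[symmetric]) (simp add: mult.commute)
  also have "\<dots> = (\<Sum>g\<in>{..<k} \<rightarrow>\<^sub>E {..<n}. (\<Prod>i<k. Q (g i) i) * det (mat k k (\<lambda>(i, j). P j (g i))))"
    by (rule det_mat_sum_rows)
  finally show ?thesis by (simp add: mult.commute det_mat_swap[of k "\<lambda>i j. P i (_ j)"])
qed

lemma det_repeated_rows:
  assumes "\<not> inj_on f {..<k}"
  shows "det (mat k k (\<lambda>(i, j). A (f i) j)) = 0"
proof -
  obtain i i' where "i < k" "i' < k" "i \<noteq> i'" "f i = f i'"
    using assms by (auto simp: inj_on_def)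
  then show ?thesis
    by (intro det_identical_rows[where n = k and i = i and j = i']) (auto intro!: eq_vecI)
qed

text \<open>The factor \<open>s\<close> is the sign of the permutation that sorts the values of \<open>f\<close>; the order-preserving
  enumeration \<open>pick\<close> of a set of indices is the one that occurs in submatrices.\<close>

lemma det_rows_pick:
  assumes "inj_on f {..<k}"
  shows "\<exists>s. det (mat k k (\<lambda>(i, j). A (f i) j)) = s * det (mat k k (\<lambda>(i, j). A (pick (f ` {..<k}) i) j))"
proof -
  define I where "I = f ` {..<k}"
  have "card I = k" using assms by (simp add: I_def card_image)
  have "finite I" by (simp add: I_def)
  define p where "p i = (if i < k then card {a \<in> I. a < f i} else i)" for i
  have pick: "pick I (p i) = f i" if "i < k" for i
    using that by (auto simp: p_def I_def intro!: pick_card_in_set)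
  have p_less: "p i < k" if "i < k" for i
  proof -
    have "{a \<in> I. a < f i} \<subset> I" using that by (auto simp: I_def)
    then show ?thesis using \<open>card I = k\<close> \<open>finite I\<close> that by (auto simp: p_def dest: psubset_card_mono)
  qed
  have "inj_on p {0..<k}"
    using pick assms unfolding inj_on_def by (metis atLeastLessThan_iff lessThan_iff)
  then have "p ` {0..<k} = {0..<k}"
    using p_less by (intro endo_inj_surj) auto
  then have "bij_betw p {0..<k} {0..<k}"
    using \<open>inj_on p {0..<k}\<close> by (simp add: bij_betw_def)
  then have p: "p permutes {0..<k}"
    by (rule bij_imp_permutes) (auto simp: p_def)
  have "mat k k (\<lambda>(i, j). A (f i) j) = mat k k (\<lambda>(i, j). mat k k (\<lambda>(i, j). A (pick I i) j) $$ (p i, j))"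
    using pick p_less by (intro eq_matI) auto
  then show ?thesis
    using det_permute_rows[OF _ p, of "mat k k (\<lambda>(i, j). A (pick I i) j)"] by (auto simp: I_def)
qed

text \<open>Selecting rows and columns along arbitrary index maps gives zero in the presence of a repetition,
  and a minor up to sign otherwise.\<close>

lemma det_select_in_det_divisor:
  fixes A :: "'a::comm_ring_1 mat"
  assumes A: "A \<in> carrier_mat n n" and f: "f ` {..<k} \<subseteq> {..<n}" and g: "g ` {..<k} \<subseteq> {..<n}"
  shows "det (mat k k (\<lambda>(i, j). A $$ (f i, g j))) \<in> det_divisor k A"
proof (cases "inj_on f {..<k} \<and> inj_on g {..<k}")
  case True
  define I J where "I = f ` {..<k}" and "J = g ` {..<k}"
  obtain s where "det (mat k k (\<lambda>(i, j). A $$ (f i, g j)))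
      = s * det (mat k k (\<lambda>(i, j). A $$ (pick I i, g j)))"
    using det_rows_pick[of f k "\<lambda>i j. A $$ (i, g j)"] True by (auto simp: I_def)
  moreover obtain t where "det (mat k k (\<lambda>(j, i). A $$ (pick I i, g j)))
      = t * det (mat k k (\<lambda>(j, i). A $$ (pick I i, pick J j)))"
    using det_rows_pick[of g k "\<lambda>j i. A $$ (pick I i, j)"] True by (auto simp: J_def)
  ultimately have "det (mat k k (\<lambda>(i, j). A $$ (f i, g j)))
      = s * (t * det (mat k k (\<lambda>(i, j). A $$ (pick I i, pick J j))))"
    using det_mat_swap[of k "\<lambda>i j. A $$ (pick I i, g j)"]
      det_mat_swap[of k "\<lambda>i j. A $$ (pick I i, pick J j)"] by simp
  moreover have "card I = k" "card J = k" using True by (simp_all add: I_def J_def card_image)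
  moreover have "{i. i < n \<and> i \<in> I} = I" "{j. j < n \<and> j \<in> J} = J"
    using f g by (auto simp: I_def J_def)
  ultimately have eq: "det (mat k k (\<lambda>(i, j). A $$ (f i, g j))) = s * (t * det (submatrix A I J))"
    using A by (simp add: submatrix_def)
  have "det (submatrix A I J) \<in> minors k A"
    using A f g \<open>card I = k\<close> \<open>card J = k\<close> by (auto simp: minors_def I_def J_def)
  then have "det (submatrix A I J) \<in> det_divisor k A"
    unfolding det_divisor_def using ideal_gen_superset by blast
  then show ?thesis unfolding eq det_divisor_def by (intro ideal_gen_mult)
next
  case False
  then have "det (mat k k (\<lambda>(i, j). A $$ (f i, g j))) = 0"
    using det_repeated_rows[of f k "\<lambda>i j. A $$ (i, g j)"]
      det_repeated_rows[of g k "\<lambda>j i. A $$ (f i, j)"]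
      det_mat_swap[of k "\<lambda>i j. A $$ (f i, g j)"] by auto
  then show ?thesis
    using is_ideal_gen[of "minors k A"] by (simp add: det_divisor_def is_ideal_iff)
qed

lemma det_in_prod:
  fixes M :: "nat \<Rightarrow> 'a::idom submod"
  assumes "\<And>i j. i < k \<Longrightarrow> j < k \<Longrightarrow> A i j \<in> elts (M i)"
  shows "det (mat k k (\<lambda>(i, j). A i j)) \<in> elts (\<Prod>i<k. M i)"
proof -
  have "signof p * (\<Prod>i = 0..<k. mat k k (\<lambda>(i, j). A i j) $$ (i, p i)) \<in> elts (\<Prod>i<k. M i)"
    if p: "p permutes {0..<k}" for p
  proof -
    have "(\<Prod>i = 0..<k. mat k k (\<lambda>(i, j). A i j) $$ (i, p i)) \<in> elts (\<Prod>i<k. M i)"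
      unfolding lessThan_atLeast0
      using assms permutes_in_image[OF p] by (intro elts_prod) auto
    then show ?thesis by (auto simp: sign_def elts_uminus)
  qed
  then show ?thesis
    by (subst det_def'[where n = k]) (auto intro!: elts_sum)
qed

text \<open>The \<open>i\<close>-th smallest element of \<open>I\<close> is at least \<open>i\<close>. In the induction the largest element of \<open>I\<close>, which
  is at least \<open>k\<close>, is compared with \<open>k\<close>.\<close>

lemma antitone_prod_le:
  fixes \<beta> :: "nat \<Rightarrow> 'a::idom submod"
  assumes anti: "\<And>i j. i \<le> j \<Longrightarrow> j < n \<Longrightarrow> \<beta> j \<le> \<beta> i" and I: "I \<subseteq> {..<n}" "card I = k"
  shows "(\<Prod>i\<in>I. \<beta> i) \<le> (\<Prod>i<k. \<beta> i)"
  using I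
proof (induction k arbitrary: I)
  case 0
  then have "I = {}" using finite_subset by fastforce
  then show ?case by simp
next
  case (Suc k)
  have fin: "finite I" using Suc.prems(1) finite_subset by blast
  then have ne: "I \<noteq> {}" using Suc.prems(2) by auto
  define m where "m = Max I"
  have m: "m \<in> I" using fin ne by (simp add: m_def)
  have "I - {m} \<subseteq> {..<m}" using Max_ge[OF fin] by (auto simp: m_def order.strict_iff_order)
  then have "k \<le> m"
    using card_mono[of "{..<m}" "I - {m}"] m fin Suc.prems(2) by simp
  moreover have "m < n" using m Suc.prems(1) by auto
  ultimately have "\<beta> m \<le> \<beta> k" by (rule anti)
  moreover have "(\<Prod>i\<in>I - {m}. \<beta> i) \<le> (\<Prod>i<k. \<beta> i)"
    using Suc.prems m fin by (intro Suc.IH) auto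
  ultimately have "\<beta> m * (\<Prod>i\<in>I - {m}. \<beta> i) \<le> \<beta> k * (\<Prod>i<k. \<beta> i)"
    by (rule submod_mult_mono)
  then show ?case using m fin by (simp add: prod.remove mult.commute)
qed

section \<open>Determinantal divisors of maps between direct sums\<close>

lemma to_fract_comm_ring_hom: "comm_ring_hom (to_fract :: 'a::idom \<Rightarrow> 'a fract)"
  by unfold_locales auto

lemma det_to_fract:
  fixes A :: "nat \<Rightarrow> nat \<Rightarrow> 'a::idom"
  shows "det (mat k k (\<lambda>(i, j). to_fract (A i j))) = to_fract (det (mat k k (\<lambda>(i, j). A i j)))"
proof -
  interpret comm_ring_hom "to_fract :: 'a \<Rightarrow> _" by (rule to_fract_comm_ring_hom)
  have "mat k k (\<lambda>(i, j). to_fract (A i j)) = map_mat to_fract (mat k k (\<lambda>(i, j). A i j))"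
    by (rule eq_matI) auto
  then show ?thesis by simp
qed

text \<open>\<open>X\<close> and \<open>Z\<close> are bases of \<open>\<sigma>\<^sub>0 \<oplus> \<dots> \<oplus> \<sigma>\<^sub>n\<^sub>-\<^sub>1\<close> and \<open>\<sigma>\<^sub>0\<beta>\<^sub>0 \<oplus> \<dots> \<oplus> \<sigma>\<^sub>n\<^sub>-\<^sub>1\<beta>\<^sub>n\<^sub>-\<^sub>1\<close>, and \<open>B = X\<inverse> Z\<close> describes the
  inclusion between them.

  For \<open>\<le>\<close>, expand a minor of \<open>X' Z\<close> along the rows: the summand of an injective \<open>f\<close> lies in
  \<open>\<Prod>\<sigma>\<^sub>j\<inverse> \<cdot> \<Prod>\<sigma>\<^sub>j\<beta>\<^sub>j = \<Prod>\<beta>\<^sub>j\<close>, where \<open>j\<close> runs through the values of \<open>f\<close>, and this is largest for the first \<open>k\<close>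
  indices.

  For \<open>\<ge>\<close>, expand the leading minor \<open>1\<close> of \<open>X B Z' = 1\<close> along rows and columns. Every summand contains a
  determinant selected from \<open>B\<close>, hence
  \<open>1 \<in> \<Prod>\<sigma>\<^sub>i \<cdot> D \<cdot> \<Prod>(\<sigma>\<^sub>i\<beta>\<^sub>i)\<inverse> = D \<cdot> \<Prod>\<beta>\<^sub>i\<inverse>\<close> for the determinantal divisor \<open>D\<close>.\<close>

lemma det_divisor_between_sums:
  fixes \<sigma> \<beta> :: "nat \<Rightarrow> 'a::idom submod" and B :: "'a mat"
  assumes inv: "\<And>i. i < n \<Longrightarrow> invertible_mod (\<sigma> i)" "\<And>i. i < n \<Longrightarrow> invertible_mod (\<beta> i)"
    and anti: "\<And>i j. i \<le> j \<Longrightarrow> j < n \<Longrightarrow> \<beta> j \<le> \<beta> i"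
    and X: "X \<in> hom_mats n (\<lambda>_. 1) \<sigma>" "X' \<in> hom_mats n \<sigma> (\<lambda>_. 1)" "X * X' = 1\<^sub>m n"
    and Z: "Z \<in> hom_mats n (\<lambda>_. 1) (\<lambda>i. \<sigma> i * \<beta> i)" "Z' \<in> hom_mats n (\<lambda>i. \<sigma> i * \<beta> i) (\<lambda>_. 1)"
      "Z * Z' = 1\<^sub>m n"
    and B: "B \<in> carrier_mat n n" "map_mat to_fract B = X' * Z"
    and k: "k \<le> n"
  shows "of_ideal (det_divisor k B) = (\<Prod>i<k. \<beta> i)"
proof (rule antisym)
  note carriers = X(1,2)[THEN hom_mats_carrier] Z(1,2)[THEN hom_mats_carrier]
  have B_index: "to_fract (B $$ (i, j)) = (\<Sum>l<n. X' $$ (i, l) * Z $$ (l, j))" if "i < n" "j < n" for i j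
  proof -
    have "to_fract (B $$ (i, j)) = map_mat to_fract B $$ (i, j)" using B(1) that by simp
    then show ?thesis unfolding B(2) using times_mat_index[OF carriers(2,3) that] by simp
  qed
  show "of_ideal (det_divisor k B) \<le> (\<Prod>i<k. \<beta> i)"
    unfolding of_ideal_le_iff det_divisor_def
  proof (subst ideal_gen_subset_iff[OF is_ideal_integral_part], rule subsetI)
    fix d assume "d \<in> minors k B"
    then obtain I J where IJ: "I \<subseteq> {..<n}" "J \<subseteq> {..<n}" "card I = k" "card J = k"
      and d: "d = det (submatrix B I J)"
      using B(1) by (auto simp: minors_def)
    have pick: "pick I i < n" "pick J i < n" if "i < k" for i
      using that IJ pick_in_set_le[of i I] pick_in_set_le[of i J] by auto
    have "{i. i < n \<and> i \<in> I} = I" "{j. j < n \<and> j \<in> J} = J" using IJ by auto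
    then have "submatrix B I J = mat k k (\<lambda>(i, j). B $$ (pick I i, pick J j))"
      using B(1) IJ by (simp add: submatrix_def)
    then have "to_fract d = det (mat k k (\<lambda>(i, j). to_fract (B $$ (pick I i, pick J j))))"
      by (simp add: d det_to_fract)
    also have "mat k k (\<lambda>(i, j). to_fract (B $$ (pick I i, pick J j)))
        = mat k k (\<lambda>(i, j). \<Sum>l<n. X' $$ (pick I i, l) * Z $$ (l, pick J j))"
      by (intro eq_matI) (auto simp: B_index pick)
    also have "det \<dots> \<in> elts (\<Prod>i<k. \<beta> i)"
      unfolding det_mat_sum_rows
    proof (rule elts_sum)
      fix f assume f: "f \<in> {..<k} \<rightarrow>\<^sub>E {..<n}"
      then have fn: "f i < n" if "i < k" for i using that by auto
      show "(\<Prod>i<k. X' $$ (pick I i, f i)) * det (mat k k (\<lambda>(i, j). Z $$ (f i, pick J j))) \<in> elts (\<Prod>i<k. \<beta> i)"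
      proof (cases "inj_on f {..<k}")
        case True
        have "(\<Prod>i<k. X' $$ (pick I i, f i)) \<in> elts (\<Prod>i<k. inv_mod (\<sigma> (f i)))"
          using hom_mats_index[OF X(2)] pick fn by (intro elts_prod) simp
        moreover have "det (mat k k (\<lambda>(i, j). Z $$ (f i, pick J j))) \<in> elts (\<Prod>i<k. \<sigma> (f i) * \<beta> (f i))"
          using hom_mats_index[OF Z(1)] pick fn by (intro det_in_prod) simp
        ultimately have "(\<Prod>i<k. X' $$ (pick I i, f i)) * det (mat k k (\<lambda>(i, j). Z $$ (f i, pick J j)))
            \<in> elts ((\<Prod>i<k. inv_mod (\<sigma> (f i))) * (\<Prod>i<k. \<sigma> (f i) * \<beta> (f i)))"
          by (rule times_elts)
        also have "(\<Prod>i<k. inv_mod (\<sigma> (f i))) * (\<Prod>i<k. \<sigma> (f i) * \<beta> (f i)) = (\<Prod>i<k. \<beta> (f i))"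
          unfolding prod.distrib[symmetric] using fn inv by (intro prod.cong) auto
        also have "\<dots> = (\<Prod>i\<in>f ` {..<k}. \<beta> i)"
          using True by (simp add: prod.reindex)
        finally have "(\<Prod>i<k. X' $$ (pick I i, f i)) * det (mat k k (\<lambda>(i, j). Z $$ (f i, pick J j)))
            \<in> elts (\<Prod>i\<in>f ` {..<k}. \<beta> i)" .
        moreover have "(\<Prod>i\<in>f ` {..<k}. \<beta> i) \<le> (\<Prod>i<k. \<beta> i)"
          using anti fn True by (intro antitone_prod_le[where n = n]) (auto simp: card_image)
        ultimately show ?thesis by (rule submod_leD[rotated])
      next
        case False
        then show ?thesis
          using det_repeated_rows[of f k "\<lambda>i j. Z $$ (i, pick J j)"] by simp
      qed
    qed
    finally show "d \<in> integral_part (\<Prod>i<k. \<beta> i)" by (simp add: integral_part_def)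
  qed
  show "(\<Prod>i<k. \<beta> i) \<le> of_ideal (det_divisor k B)"
  proof -
    let ?D = "of_ideal (det_divisor k B)"
    let ?B = "map_mat to_fract B"
    have Bc: "?B \<in> carrier_mat n n" using B(1) by simp
    have BZc: "?B * Z' \<in> carrier_mat n n" using Bc carriers by simp
    have "X * (?B * Z') = (X * X') * (Z * Z')"
      unfolding B(2) using carriers
      by (simp add: assoc_mult_mat[where n\<^sub>1=n and n\<^sub>2=n and n\<^sub>3=n and n\<^sub>4=n] mult_carrier_mat[where nr=n and n=n and nc=n])
    then have "X * (?B * Z') = 1\<^sub>m n" using X(3) Z(3) by simp
    then have one: "(\<Sum>l<n. X $$ (i, l) * (?B * Z') $$ (l, j)) = (if i = j then 1 else 0)"
      if "i < n" "j < n" for i j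
      using times_mat_index[OF carriers(1) BZc that] that by simp
    have "mat k k (\<lambda>(i, j). \<Sum>l<n. X $$ (i, l) * (?B * Z') $$ (l, j)) = 1\<^sub>m k"
      using k by (intro eq_matI) (auto simp: one)
    then have "1 = det (mat k k (\<lambda>(i, j). \<Sum>l<n. X $$ (i, l) * (?B * Z') $$ (l, j)))"
      by simp
    also have "\<dots> \<in> elts ((\<Prod>i<k. \<sigma> i) * (?D * (\<Prod>i<k. inv_mod (\<sigma> i * \<beta> i))))"
      unfolding det_mat_sum_rows
    proof (intro elts_sum times_elts)
      fix f assume f: "f \<in> {..<k} \<rightarrow>\<^sub>E {..<n}"
      then have fn: "f i < n" if "i < k" for i using that by auto
      show "(\<Prod>i<k. X $$ (i, f i)) \<in> elts (\<Prod>i<k. \<sigma> i)"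
        using hom_mats_index[OF X(1)] k fn by (intro elts_prod) simp
      have "mat k k (\<lambda>(i, j). (?B * Z') $$ (f i, j)) = mat k k (\<lambda>(i, j). \<Sum>l<n. ?B $$ (f i, l) * Z' $$ (l, j))"
        using k fn by (intro eq_matI) (auto simp: times_mat_index[OF Bc carriers(4)])
      also have "det \<dots> \<in> elts (?D * (\<Prod>i<k. inv_mod (\<sigma> i * \<beta> i)))"
        unfolding det_mat_sum_cols
      proof (intro elts_sum times_elts)
        fix g assume g: "g \<in> {..<k} \<rightarrow>\<^sub>E {..<n}"
        then have gn: "g i < n" if "i < k" for i using that by auto
        show "(\<Prod>j<k. Z' $$ (g j, j)) \<in> elts (\<Prod>i<k. inv_mod (\<sigma> i * \<beta> i))"
          using hom_mats_index[OF Z(2)] k gn by (intro elts_prod) simp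
        have "mat k k (\<lambda>(i, j). ?B $$ (f i, g j)) = mat k k (\<lambda>(i, j). to_fract (B $$ (f i, g j)))"
          using fn gn B(1) by (intro eq_matI) auto
        then have "det (mat k k (\<lambda>(i, j). ?B $$ (f i, g j))) = to_fract (det (mat k k (\<lambda>(i, j). B $$ (f i, g j))))"
          by (simp add: det_to_fract)
        moreover have "det (mat k k (\<lambda>(i, j). B $$ (f i, g j))) \<in> det_divisor k B"
          using f g by (intro det_select_in_det_divisor[OF B(1)]) auto
        ultimately show "det (mat k k (\<lambda>(i, j). ?B $$ (f i, g j))) \<in> elts ?D"
          unfolding of_ideal_def by (auto intro!: generated_base simp: frac_ideal_def)
      qed
      finally show "det (mat k k (\<lambda>(i, j). (?B * Z') $$ (f i, j))) \<in> elts (?D * (\<Prod>i<k. inv_mod (\<sigma> i * \<beta> i)))" .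
    qed
    finally have "1 \<le> (\<Prod>i<k. \<sigma> i) * (?D * (\<Prod>i<k. inv_mod (\<sigma> i * \<beta> i)))"
      by (simp add: one_le_iff)
    also have "\<dots> = ?D * (\<Prod>i<k. \<sigma> i * inv_mod (\<sigma> i * \<beta> i))"
      by (simp add: prod.distrib mult_ac)
    also have "(\<Prod>i<k. \<sigma> i * inv_mod (\<sigma> i * \<beta> i)) = (\<Prod>i<k. inv_mod (\<beta> i))"
      using k inv by (intro prod.cong) (auto simp: inv_mod_mult)
    finally have "(\<Prod>i<k. \<beta> i) * 1 \<le> (\<Prod>i<k. \<beta> i) * (?D * (\<Prod>i<k. inv_mod (\<beta> i)))"
      by (rule submod_mult_left_mono)
    also have "\<dots> = ?D * (\<Prod>i<k. \<beta> i * inv_mod (\<beta> i))"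
      by (simp add: prod.distrib mult_ac)
    also have "(\<Prod>i<k. \<beta> i * inv_mod (\<beta> i)) = 1"
      using k inv by (intro prod.neutral) auto
    finally show ?thesis by simp
  qed
qed

section \<open>Invariant factors and realisability\<close>

text \<open>\<open>\<alpha>\<^sub>i = F\<^sub>i\<inverse> F\<^sub>i\<^sub>+\<^sub>1\<close>; the inequality \<open>\<alpha>\<^sub>k\<^sub>+\<^sub>1 \<le> \<alpha>\<^sub>k\<close> is the log-concavity of \<open>F\<close> divided by \<open>F\<^sub>k F\<^sub>k\<^sub>+\<^sub>1\<close>.\<close>

lemma invariant_factorsE:
  fixes F :: "nat \<Rightarrow> 'a::idom submod"
  assumes F0: "F 0 = 1" and F1: "F 1 \<le> 1"
    and inv: "\<And>k. k \<le> n \<Longrightarrow> invertible_mod (F k)"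
    and log_concave: "\<And>k. Suc (Suc k) \<le> n \<Longrightarrow> F (Suc (Suc k)) * F k \<le> F (Suc k) * F (Suc k)"
  obtains \<alpha> where "\<And>i. i < n \<Longrightarrow> invertible_mod (\<alpha> i)" "\<And>i. i < n \<Longrightarrow> \<alpha> i \<le> 1"
    "\<And>i j. i \<le> j \<Longrightarrow> j < n \<Longrightarrow> \<alpha> j \<le> \<alpha> i" "\<And>k. k \<le> n \<Longrightarrow> (\<Prod>i<k. \<alpha> i) = F k"
proof
  define \<alpha> where "\<alpha> i = inv_mod (F i) * F (Suc i)" for i
  show "invertible_mod (\<alpha> i)" if "i < n" for i
    using that by (simp add: \<alpha>_def inv)
  show "(\<Prod>i<k. \<alpha> i) = F k" if "k \<le> n" for k
    using that by (induction k) (simp_all add: F0 \<alpha>_def inv)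
  have step: "\<alpha> (Suc k) \<le> \<alpha> k" if k: "Suc k < n" for k
  proof -
    let ?J = "inv_mod (F (Suc k)) * inv_mod (F k)"
    have "?J * (F (Suc (Suc k)) * F k) \<le> ?J * (F (Suc k) * F (Suc k))"
      using k by (intro submod_mult_left_mono log_concave) simp
    also have "?J * (F (Suc k) * F (Suc k)) = (inv_mod (F (Suc k)) * F (Suc k)) * \<alpha> k"
      by (simp add: \<alpha>_def mult_ac)
    also have "?J * (F (Suc (Suc k)) * F k) = (inv_mod (F k) * F k) * \<alpha> (Suc k)"
      by (simp add: \<alpha>_def mult_ac)
    finally show ?thesis using k inv by simp
  qed
  show anti: "\<alpha> j \<le> \<alpha> i" if "i \<le> j" "j < n" for i j
    using that by (induction j rule: dec_induct) (auto intro: order_trans[OF step])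
  show "\<alpha> i \<le> 1" if "i < n" for i
    using anti[of 0 i] that F1 by (auto simp: \<alpha>_def F0)
qed

lemma integral_mat:
  fixes X :: "'a::idom fract mat"
  assumes "X \<in> carrier_mat n n" "\<And>i j. i < n \<Longrightarrow> j < n \<Longrightarrow> X $$ (i, j) \<in> elts 1"
  shows "\<exists>A\<in>carrier_mat n n. map_mat to_fract A = X"
proof -
  have "\<exists>r. i < n \<longrightarrow> j < n \<longrightarrow> X $$ (i, j) = to_fract r" for i j
    using assms(2)[of i j] by (auto simp: elts_one)
  then obtain r where "\<And>i j. i < n \<Longrightarrow> j < n \<Longrightarrow> X $$ (i, j) = to_fract (r i j)" by metis
  then show ?thesis
    using assms(1) by (intro bexI[of _ "mat n n (\<lambda>(i, j). r i j)"] eq_matI) auto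
qed

context dedekind
begin

text \<open>\<open>A = X\<close> for a basis \<open>X\<close> of \<open>\<Oplus>\<alpha>\<^sub>i\<close>, and \<open>B = X\<inverse> Z\<close> for a basis \<open>Z\<close> of \<open>\<Oplus>\<alpha>\<^sub>i\<beta>\<^sub>i\<close>; the inclusions
  \<open>\<Oplus>\<alpha>\<^sub>i\<beta>\<^sub>i \<subseteq> \<Oplus>\<alpha>\<^sub>i \<subseteq> o\<^sup>n\<close> make both integral. The divisors of \<open>A\<close> and of \<open>A B = Z\<close> are those of inclusions
  into \<open>o\<^sup>n\<close>, where the reference basis is the standard one.\<close>

lemma ex_factored_mats:
  fixes \<alpha> \<beta> :: "nat \<Rightarrow> 'a submod"
  assumes n: "n \<ge> 1"
    and inv: "\<And>i. i < n \<Longrightarrow> invertible_mod (\<alpha> i)" "\<And>i. i < n \<Longrightarrow> invertible_mod (\<beta> i)"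
    and integral: "\<And>i. i < n \<Longrightarrow> \<alpha> i \<le> 1" "\<And>i. i < n \<Longrightarrow> \<beta> i \<le> 1"
    and anti: "\<And>i j. i \<le> j \<Longrightarrow> j < n \<Longrightarrow> \<alpha> j \<le> \<alpha> i" "\<And>i j. i \<le> j \<Longrightarrow> j < n \<Longrightarrow> \<beta> j \<le> \<beta> i"
    and g: "(\<Prod>i<n. \<alpha> i) = cyclic g" and h: "(\<Prod>i<n. \<beta> i) = cyclic h"
  shows "\<exists>A\<in>nonsing_mats n. \<exists>B\<in>nonsing_mats n. \<forall>k\<le>n.
    of_ideal (det_divisor k A) = (\<Prod>i<k. \<alpha> i) \<and> of_ideal (det_divisor k B) = (\<Prod>i<k. \<beta> i) \<and>
    of_ideal (det_divisor k (A * B)) = (\<Prod>i<k. \<alpha> i * \<beta> i)"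
proof -
  interpret to_fract: comm_ring_hom "to_fract :: 'a \<Rightarrow> 'a fract" by (rule to_fract_comm_ring_hom)
  define \<gamma> where "\<gamma> i = \<alpha> i * \<beta> i" for i
  have inv_\<gamma>: "invertible_mod (\<gamma> i)" if "i < n" for i using inv that by (simp add: \<gamma>_def)
  have anti_\<gamma>: "\<gamma> j \<le> \<gamma> i" if "i \<le> j" "j < n" for i j
    using anti that by (simp add: \<gamma>_def submod_mult_mono)
  have gh: "(\<Prod>i<n. \<gamma> i) = cyclic (g * h)" by (simp add: \<gamma>_def prod.distrib g h cyclic_mult)
  obtain X X' where X: "X \<in> hom_mats n (\<lambda>_. 1) \<alpha>" "X' \<in> hom_mats n \<alpha> (\<lambda>_. 1)" "X * X' = 1\<^sub>m n"
    using steinitz_free[OF n inv(1) g] by (auto simp: isomorphic_sums_def)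
  obtain Z Z' where Z: "Z \<in> hom_mats n (\<lambda>_. 1) \<gamma>" "Z' \<in> hom_mats n \<gamma> (\<lambda>_. 1)" "Z * Z' = 1\<^sub>m n"
    using steinitz_free[OF n inv_\<gamma> gh] by (auto simp: isomorphic_sums_def)
  note carriers = X(1,2)[THEN hom_mats_carrier] Z(1,2)[THEN hom_mats_carrier]
  have "X $$ (i, j) \<in> elts 1" if "i < n" "j < n" for i j
    using hom_mats_index[OF X(1) that] integral(1)[OF that(1)] by (auto dest: submod_leD)
  then obtain A where A: "A \<in> carrier_mat n n" "map_mat to_fract A = X"
    using integral_mat[OF carriers(1)] by blast
  have X'Z: "X' * Z \<in> carrier_mat n n" using carriers by simp
  have "(X' * Z) $$ (i, j) \<in> elts 1" if ij: "i < n" "j < n" for i j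
    unfolding times_mat_index[OF carriers(2,3) ij]
  proof (rule elts_sum)
    fix l assume "l \<in> {..<n}"
    then have l: "l < n" by simp
    have "X' $$ (i, l) * Z $$ (l, j) \<in> elts ((1 * inv_mod (\<alpha> l)) * (\<gamma> l * inv_mod 1))"
      by (intro times_elts hom_mats_index[OF X(2)] hom_mats_index[OF Z(1)] ij l)
    also have "(1 * inv_mod (\<alpha> l)) * (\<gamma> l * inv_mod 1) = \<beta> l" using inv l by (simp add: \<gamma>_def)
    finally show "X' $$ (i, l) * Z $$ (l, j) \<in> elts 1" using integral(2)[OF l] by (rule submod_leD[rotated])
  qed
  then obtain B where B: "B \<in> carrier_mat n n" "map_mat to_fract B = X' * Z"
    using integral_mat[OF X'Z] by blast
  have "map_mat to_fract (A * B) = X * (X' * Z)"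
    using A B by (simp add: to_fract.mat_hom_mult[of A n n B n])
  also have "\<dots> = (X * X') * Z" using carriers by simp
  finally have AB: "A * B \<in> carrier_mat n n" "map_mat to_fract (A * B) = Z"
    using A B X(3) carriers by simp_all
  have "det Z * det Z' = 1" using Z(3) carriers by (metis det_mult det_one)
  then have "det (A * B) \<noteq> 0" using to_fract.hom_det[of "A * B"] AB(2) by auto
  then have "det A \<noteq> 0" "det B \<noteq> 0" using A(1) B(1) by (auto simp: det_mult)
  then have nonsing: "A \<in> nonsing_mats n" "B \<in> nonsing_mats n"
    using A(1) B(1) by (auto simp: nonsing_mats_def)
  have one: "1\<^sub>m n \<in> hom_mats n (\<lambda>_. 1) (\<lambda>_. 1 :: 'a submod)" by (auto simp: hom_mats_def)
  have one': "1\<^sub>m n * 1\<^sub>m n = (1\<^sub>m n :: 'a fract mat)" by (rule left_mult_one_mat[OF one_carrier_mat])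
  have "of_ideal (det_divisor k A) = (\<Prod>i<k. \<alpha> i)" if "k \<le> n" for k
    using X that A carriers
    by (intro det_divisor_between_sums[OF _ inv(1) anti(1) one one one']) auto
  moreover have "of_ideal (det_divisor k B) = (\<Prod>i<k. \<beta> i)" if "k \<le> n" for k
    using Z that B
    by (intro det_divisor_between_sums[OF inv(1) inv(2) anti(2) X]) (auto simp: \<gamma>_def[abs_def])
  moreover have "of_ideal (det_divisor k (A * B)) = (\<Prod>i<k. \<gamma> i)" if "k \<le> n" for k
    using Z that AB carriers
    by (intro det_divisor_between_sums[OF _ inv_\<gamma> anti_\<gamma> one one one']) auto
  ultimately show ?thesis using nonsing unfolding \<gamma>_def by blast
qed

end

theorem corollary4p3:
  fixes a b c :: "nat \<Rightarrow> 'a::idom set" and n :: nat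
  assumes dedekind: "dedekind_domain TYPE('a)"
    and n: "n \<ge> 1"
    and ideals: "\<forall>d\<in>{a, b, c}. \<forall>k\<in>{1..n}. is_ideal (d k) \<and> d k \<noteq> {0}"
    and product: "\<forall>k\<in>{1..n}. c k = ideal_mult (a k) (b k)"
    and cond1: "principal_ideal (a n) \<and> principal_ideal (b n) \<and> principal_ideal (c n)"
    and cond2: "n \<ge> 2 \<longrightarrow> (\<forall>d\<in>{a, b, c}. ideal_divides (ideal_mult (d 1) (d 1)) (d 2))"
    and cond3: "\<forall>k\<in>{3..n}. \<forall>d\<in>{a, b, c}.
      ideal_divides
        (frac_mult (frac_mult (frac_ideal (d (k - 1))) (frac_ideal (d (k - 1))))
                   (frac_inverse (frac_ideal (d (k - 2)))))
        (frac_ideal (d k))"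
  shows "realisable n a b c"
proof -
  interpret dedekind "TYPE('a)" by standard (rule dedekind)
  \<comment> \<open>The value 1 at index 0 turns the condition on the second ideal into an instance of the later ones.\<close>
  define F where "F d k = (if k = 0 then 1 else of_ideal (d k))" for d :: "nat \<Rightarrow> 'a set" and k
  have ideal: "is_ideal (d k)" "d k \<noteq> {0}" if "d \<in> {a, b, c}" "1 \<le> k" "k \<le> n" for d k
    using ideals that by auto
  have F0: "F d 0 = 1" for d by (simp add: F_def)
  have F: "F d k = of_ideal (d k)" if "1 \<le> k" for d k using that by (simp add: F_def)
  have F1: "F d 1 \<le> 1" for d by (simp add: F of_ideal_le_one)
  have inv: "invertible_mod (F d k)" if "d \<in> {a, b, c}" "k \<le> n" for d k
    using ideal[OF that(1) _ that(2)]
    by (cases "k = 0") (simp_all add: F0 F ideal_invertible of_ideal_nonzero of_ideal_le_one)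
  have concave: "F d (Suc (Suc k)) * F d k \<le> F d (Suc k) * F d (Suc k)"
    if d: "d \<in> {a, b, c}" and k: "Suc (Suc k) \<le> n" for d k
  proof (cases "k = 0")
    case True
    have "d 2 \<subseteq> ideal_mult (d 1) (d 1)"
      using cond2 d k True by (auto simp: ideal_divides_def)
    then have "of_ideal (d 2) \<le> of_ideal (ideal_mult (d 1) (d 1))"
      by (intro of_ideal_mono) (simp add: ideal_mult_def is_ideal_gen)
    then show ?thesis
      using ideal(1)[OF d, of 1] k True by (simp add: F_def of_ideal_mult numeral_2_eq_2)
  next
    case False
    then have "Suc (Suc k) \<in> {3..n}" using k by auto
    from cond3[rule_format, OF this d]
    have "frac_ideal (d (Suc (Suc k))) \<subseteq>
        frac_mult (frac_mult (frac_ideal (d (Suc k))) (frac_ideal (d (Suc k)))) (frac_inverse (frac_ideal (d k)))"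
      by (simp add: ideal_divides_def)
    moreover have "frac_ideal (d i) = elts (F d i)" if "1 \<le> i" "i \<le> n" for i
      using ideal(1)[OF d that] that by (simp add: elts_of_ideal F)
    ultimately have "F d (Suc (Suc k)) \<le> (F d (Suc k) * F d (Suc k)) * inv_mod (F d k)"
      using False k by (simp add: frac_mult_elts frac_inverse_elts less_eq_submod_def)
    then have "F d (Suc (Suc k)) * F d k \<le> (F d (Suc k) * F d (Suc k)) * inv_mod (F d k) * F d k"
      by (rule submod_mult_right_mono)
    then show ?thesis using inv[OF d, of k] k by (simp add: mult.assoc)
  qed
  obtain \<alpha> where \<alpha>: "\<And>i. i < n \<Longrightarrow> invertible_mod (\<alpha> i)" "\<And>i. i < n \<Longrightarrow> \<alpha> i \<le> 1"
    "\<And>i j. i \<le> j \<Longrightarrow> j < n \<Longrightarrow> \<alpha> j \<le> \<alpha> i" "\<And>k. k \<le> n \<Longrightarrow> (\<Prod>i<k. \<alpha> i) = F a k"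
    by (rule invariant_factorsE[of "F a" n]) (use F0 F1 inv concave in auto)
  obtain \<beta> where \<beta>: "\<And>i. i < n \<Longrightarrow> invertible_mod (\<beta> i)" "\<And>i. i < n \<Longrightarrow> \<beta> i \<le> 1"
    "\<And>i j. i \<le> j \<Longrightarrow> j < n \<Longrightarrow> \<beta> j \<le> \<beta> i" "\<And>k. k \<le> n \<Longrightarrow> (\<Prod>i<k. \<beta> i) = F b k"
    by (rule invariant_factorsE[of "F b" n]) (use F0 F1 inv concave in auto)
  have principal: "\<exists>x. F d n = cyclic x" if "principal_ideal (d n)" for d
    using that n by (auto simp: F principal_ideal_def of_ideal_gen_singleton)
  obtain g h where "F a n = cyclic g" "F b n = cyclic h"
    using principal[of a] principal[of b] cond1 by blast
  then have gh: "(\<Prod>i<n. \<alpha> i) = cyclic g" "(\<Prod>i<n. \<beta> i) = cyclic h"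
    using \<alpha>(4) \<beta>(4) by simp_all
  obtain A B where AB: "A \<in> nonsing_mats n" "B \<in> nonsing_mats n" "\<forall>k\<le>n.
    of_ideal (det_divisor k A) = (\<Prod>i<k. \<alpha> i) \<and> of_ideal (det_divisor k B) = (\<Prod>i<k. \<beta> i) \<and>
    of_ideal (det_divisor k (A * B)) = (\<Prod>i<k. \<alpha> i * \<beta> i)"
    using ex_factored_mats[OF n \<alpha>(1) \<beta>(1) \<alpha>(2) \<beta>(2) \<alpha>(3) \<beta>(3) gh] by blast
  have "det_divisor k A = a k \<and> det_divisor k B = b k \<and> det_divisor k (A * B) = c k"
    if k: "k \<in> {1..n}" for k
  proof -
    have ideals_k: "is_ideal (a k)" "is_ideal (b k)" "is_ideal (c k)" "is_ideal (det_divisor k M)" for M :: "'a mat"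
      using ideal(1)[of _ k] k by (auto simp: det_divisor_def is_ideal_gen)
    have "of_ideal (c k) = of_ideal (a k) * of_ideal (b k)"
      using product k ideals_k by (simp add: of_ideal_mult)
    then have "of_ideal (det_divisor k A) = of_ideal (a k)" "of_ideal (det_divisor k B) = of_ideal (b k)"
        "of_ideal (det_divisor k (A * B)) = of_ideal (c k)"
      using AB(3) \<alpha>(4) \<beta>(4) k by (auto simp: prod.distrib F)
    then show ?thesis using ideals_k of_ideal_inject by blast
  qed
  then show ?thesis using AB(1,2) unfolding realisable_def by blast
qed

end
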